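(* There is an algorithm $\mathcal R^\omega$ which takes as input a nondeterministic Büchi word acceptor $M$ and has restricted subset query access (with nondeterministic Büchi word acceptors as inputs) to a language $L$ of $\omega$-words recognized by a deterministic Büchi word acceptor $T_L$, and which correctly answers the unrestricted subset query with $M$ about $L$. The algorithm $\mathcal R^\omega(M)$ runs in time bounded by a polynomial in $|M|$ and $|T_L|$. If $M$ is a deterministic Büchi word acceptor, then all the restricted subset queries made are also with deterministic Büchi word acceptors.
   Context: $\Sigma$ is a finite alphabet. A (nondeterministic) Büchi word acceptor $M=(Q,q_0,\delta,F)$ with $\delta:Q\times\Sigma\to 2^Q$ accepts an $\omega$-word iff some run visits $F$ infinitely often; it is deterministic if $|\delta(q,\sigma)|\le 1$ always; $|M|$ is the number of states. A restricted subset query about $L$ with an acceptor $N$ is answered "yes" if $L(N)\subseteq L$ and "no" otherwise. An unrestricted subset query about $L$ with $M$ is answered "yes" if $L(M)\subseteq L$, and otherwise "no" together with a pair of finite words $(u,v)$, $v$ nonempty, such that $u(v)^\omega\in L(M)\setminus L$. *)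

theory Defs
  imports "HOL-Library.Omega_Words_Fun" "HOL-Computational_Algebra.Polynomial"
begin

section \<open>Buechi word acceptors\<close>

record ('q, 'a) acceptor =
  states :: "'q set"
  initial :: 'q
  delta :: "'q \<Rightarrow> 'a \<Rightarrow> 'q set"
  accepting :: "'q set"

definition buchi :: "('q, 'a) acceptor \<Rightarrow> bool" where
  "buchi M \<longleftrightarrow> finite (states M) \<and> initial M \<in> states M \<and>
     (\<forall>q \<in> states M. \<forall>a. delta M q a \<subseteq> states M) \<and> accepting M \<subseteq> states M"

definition deterministic :: "('q, 'a) acceptor \<Rightarrow> bool" where
  "deterministic M \<longleftrightarrow> (\<forall>q \<in> states M. \<forall>a. card (delta M q a) \<le> 1)"

definition is_run :: "('q, 'a) acceptor \<Rightarrow> 'a word \<Rightarrow> 'q word \<Rightarrow> bool" where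
  "is_run M w r \<longleftrightarrow> r 0 = initial M \<and> (\<forall>i. r (Suc i) \<in> delta M (r i) (w i))"

definition language :: "('q, 'a) acceptor \<Rightarrow> 'a word set" where
  "language M = {w. \<exists>r. is_run M w r \<and> (\<exists>\<^sub>\<infinity> i. r i \<in> accepting M)}"


section \<open>Answers to unrestricted subset queries\<close>

datatype 'a answer = Yes | No "'a list" "'a list"

fun correct_answer :: "'a word set \<Rightarrow> ('q, 'a) acceptor \<Rightarrow> 'a answer \<Rightarrow> bool" where
  "correct_answer L M Yes \<longleftrightarrow> language M \<subseteq> L"
| "correct_answer L M (No u v) \<longleftrightarrow> v \<noteq> [] \<and> u \<frown> v\<^sup>\<omega> \<in> language M - L"


section \<open>Algorithms with an oracle\<close>

text \<open>
  The model of computation is a first-order functional language over binary trees (Jones's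
  language F with a local binding and an oracle call). A program is a list of function bodies,
  each with a single parameter; execution starts with the function at position 0.
  Variables are de Bruijn indices into the list of local values. In conditionals, \<open>Leaf\<close> is false
  and every other tree is true.
\<close>

datatype tree = Leaf | Node tree tree

fun left :: "tree \<Rightarrow> tree" where
  "left Leaf = Leaf"
| "left (Node x y) = x"

fun right :: "tree \<Rightarrow> tree" where
  "right Leaf = Leaf"
| "right (Node x y) = y"

fun enc_bool :: "bool \<Rightarrow> tree" where
  "enc_bool False = Leaf"
| "enc_bool True = Node Leaf Leaf"

datatype expr =
    Var nat
  | Empty
  | Pair expr expr
  | Fst expr
  | Snd expr
  | If expr expr expr
  | Let expr expr
  | Call nat expr
  | Query expr

type_synonym program = "expr list"

text \<open>
  \<open>eval P ask env e v t qs\<close>: with local values \<open>env\<close>, the expression \<open>e\<close> evaluates to \<open>v\<close>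
  in time \<open>t\<close>, making the queries \<open>qs\<close> in this order; \<open>ask x b\<close> says that the oracle
  answers \<open>b\<close> to \<open>x\<close>. Every operation takes one time unit, which is realistic because trees can
  be shared in memory. Since sharing would allow a tree to become exponentially large in its
  construction time, a query is in addition charged the size (number of \<open>Node\<close>s) of the
  tree handed to the oracle; \<open>computes\<close> does the same for the output. Time in this
  sense is polynomially related to the time of oracle Turing machines. Evaluation gets stuck on
  a query for which the oracle has no answer.
\<close>

inductive eval ::
  "program \<Rightarrow> (tree \<Rightarrow> bool \<Rightarrow> bool) \<Rightarrow> tree list \<Rightarrow> expr \<Rightarrow> tree \<Rightarrow> nat \<Rightarrow> tree list \<Rightarrow> bool"
  for P ask where
  eval_Var: "i < length env \<Longrightarrow> eval P ask env (Var i) (env ! i) 1 []"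
| eval_Empty: "eval P ask env Empty Leaf 1 []"
| eval_Pair: "eval P ask env e1 v1 t1 qs1 \<Longrightarrow> eval P ask env e2 v2 t2 qs2 \<Longrightarrow>
    eval P ask env (Pair e1 e2) (Node v1 v2) (t1 + t2 + 1) (qs1 @ qs2)"
| eval_Fst: "eval P ask env e v t qs \<Longrightarrow> eval P ask env (Fst e) (left v) (t + 1) qs"
| eval_Snd: "eval P ask env e v t qs \<Longrightarrow> eval P ask env (Snd e) (right v) (t + 1) qs"
| eval_If: "eval P ask env e v t qs \<Longrightarrow>
    eval P ask env (if v \<noteq> Leaf then e1 else e2) v' t' qs' \<Longrightarrow>
    eval P ask env (If e e1 e2) v' (t + t' + 1) (qs @ qs')"
| eval_Let: "eval P ask env e1 v t qs \<Longrightarrow> eval P ask (v # env) e2 v' t' qs' \<Longrightarrow>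
    eval P ask env (Let e1 e2) v' (t + t' + 1) (qs @ qs')"
| eval_Call: "eval P ask env e v t qs \<Longrightarrow> f < length P \<Longrightarrow> eval P ask [v] (P ! f) v' t' qs' \<Longrightarrow>
    eval P ask env (Call f e) v' (t + t' + 1) (qs @ qs')"
| eval_Query: "eval P ask env e v t qs \<Longrightarrow> ask v b \<Longrightarrow>
    eval P ask env (Query e) (enc_bool b) (t + size v + 1) (qs @ [v])"

definition computes ::
  "program \<Rightarrow> (tree \<Rightarrow> bool \<Rightarrow> bool) \<Rightarrow> tree \<Rightarrow> tree \<Rightarrow> nat \<Rightarrow> tree list \<Rightarrow> bool" where
  "computes P ask x y t qs \<longleftrightarrow>
     (\<exists>t'. 0 < length P \<and> eval P ask [x] (P ! 0) y t' qs \<and> t = t' + size y)"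


section \<open>Acceptors and answers as data of programs\<close>

fun enc_nat :: "nat \<Rightarrow> tree" where
  "enc_nat 0 = Leaf"
| "enc_nat (Suc n) = Node Leaf (enc_nat n)"

fun enc_list :: "tree list \<Rightarrow> tree" where
  "enc_list [] = Leaf"
| "enc_list (x # xs) = Node x (enc_list xs)"

text \<open>
  The list \<open>as\<close> enumerates the alphabet and \<open>qs\<close> the states. An acceptor is given by its
  transition table: for each state, two bits telling whether it is initial and whether
  it is accepting, and for each letter the characteristic bit vector of the set of successors.
  The tree does not depend on the names of the states and has size polynomial in their number.
\<close>

definition enc_acceptor :: "'a list \<Rightarrow> 'q list \<Rightarrow> ('q, 'a) acceptor \<Rightarrow> tree" where
  "enc_acceptor as qs M = enc_list (map (\<lambda>p.
     Node (enc_bool (p = initial M)) (Node (enc_bool (p \<in> accepting M))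
       (enc_list (map (\<lambda>a. enc_list (map (\<lambda>q. enc_bool (q \<in> delta M p a)) qs)) as)))) qs)"

definition encodes :: "'a list \<Rightarrow> tree \<Rightarrow> ('q, 'a) acceptor \<Rightarrow> bool" where
  "encodes as x M \<longleftrightarrow> buchi M \<and>
     (\<exists>qs. distinct qs \<and> set qs = states M \<and> x = enc_acceptor as qs M)"

text \<open>A letter is output as its position in the enumeration of the alphabet.\<close>

definition enc_word :: "'a list \<Rightarrow> 'a list \<Rightarrow> tree" where
  "enc_word as w = enc_list (map (\<lambda>a. enc_nat (length (takeWhile (\<lambda>b. b \<noteq> a) as))) w)"

fun enc_answer :: "'a list \<Rightarrow> 'a answer \<Rightarrow> tree" where
  "enc_answer as Yes = Leaf"
| "enc_answer as (No u v) = Node (enc_word as u) (enc_word as v)"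

text \<open>Restricted subset queries about \<open>L\<close>.\<close>

definition subset_oracle :: "'a list \<Rightarrow> 'a word set \<Rightarrow> tree \<Rightarrow> bool \<Rightarrow> bool" where
  "subset_oracle as L x b \<longleftrightarrow>
     (\<exists>N :: (nat, 'a) acceptor. encodes as x N \<and> (b \<longleftrightarrow> language N \<subseteq> L))"


section \<open>Well-definedness\<close>

text \<open>
  Evaluation is deterministic if the oracle is, and the subset oracle is: trees determine
  the language of the encoded acceptor.
\<close>

lemma eval_deterministic:
  assumes "\<And>x b b'. ask x b \<Longrightarrow> ask x b' \<Longrightarrow> b = b'"
    and "eval P ask env e v t qs" and "eval P ask env e v' t' qs'"
  shows "v = v' \<and> t = t' \<and> qs = qs'"
  using assms(2,3)
proof (induction arbitrary: v' t' qs' rule: eval.induct)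
  case (eval_Var i env) then show ?case by (auto elim: eval.cases)
next
  case (eval_Empty env) then show ?case by (auto elim: eval.cases)
next
  case (eval_Pair env e1 v1 t1 qs1 e2 v2 t2 qs2)
  from eval_Pair.prems show ?case
    by (cases rule: eval.cases) (use eval_Pair.IH in blast)
next
  case (eval_Fst env e v t qs)
  from eval_Fst.prems show ?case by (cases rule: eval.cases) (use eval_Fst.IH in blast)
next
  case (eval_Snd env e v t qs)
  from eval_Snd.prems show ?case by (cases rule: eval.cases) (use eval_Snd.IH in blast)
next
  case (eval_If env e v t qs e1 e2 v1 t1 qs1)
  from eval_If.prems show ?case
    by (cases rule: eval.cases) (use eval_If.IH in blast)
next
  case (eval_Let env e1 v t qs e2 v1 t1 qs1)
  from eval_Let.prems show ?case by (cases rule: eval.cases) (use eval_Let.IH in blast)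
next
  case (eval_Call env e v t qs f v1 t1 qs1)
  from eval_Call.prems show ?case by (cases rule: eval.cases) (use eval_Call.IH in blast)
next
  case (eval_Query env e v t qs b)
  from eval_Query.prems show ?case
    by (cases rule: eval.cases) (use eval_Query.IH eval_Query.hyps assms(1) in blast)
qed

lemma enc_bool_inject: "enc_bool b = enc_bool c \<longleftrightarrow> b = c"
  by (cases b; cases c) auto

lemma enc_list_inject: "enc_list xs = enc_list ys \<longleftrightarrow> xs = ys"
proof (induction xs arbitrary: ys)
  case Nil then show ?case by (cases ys) auto
next
  case (Cons x xs) then show ?case by (cases ys) auto
qed

lemma language_subset_if_enc_acceptor_eq:
  fixes M :: "('q, 'a) acceptor" and N :: "('r, 'a) acceptor"
  assumes "set as = UNIV"
    and M: "buchi M" "distinct qs" "set qs = states M"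
    and N: "buchi N" "distinct rs" "set rs = states N"
    and eq: "enc_acceptor as qs M = enc_acceptor as rs N"
  shows "language M \<subseteq> language N"
proof
  fix w assume "w \<in> language M"
  then obtain r where r: "r 0 = initial M" "\<And>i. r (Suc i) \<in> delta M (r i) (w i)"
    and inf: "\<exists>\<^sub>\<infinity> i. r i \<in> accepting M"
    by (auto simp: language_def is_run_def)
  note eq' = eq[unfolded enc_acceptor_def enc_list_inject list_eq_iff_nth_eq]
  have len: "length rs = length qs"
    using eq' by simp
  have tab: "(qs ! i = initial M \<longleftrightarrow> rs ! i = initial N) \<and>
      (qs ! i \<in> accepting M \<longleftrightarrow> rs ! i \<in> accepting N) \<and>
      (\<forall>a. \<forall>j < length qs. qs ! j \<in> delta M (qs ! i) a \<longleftrightarrow> rs ! j \<in> delta N (rs ! i) a)"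
    if "i < length qs" for i
  proof -
    have e: "map (\<lambda>a. enc_list (map (\<lambda>q. enc_bool (q \<in> delta M (qs ! i) a)) qs)) as =
        map (\<lambda>a. enc_list (map (\<lambda>q. enc_bool (q \<in> delta N (rs ! i) a)) rs)) as"
      using eq' that len by (simp add: enc_list_inject)
    have "map (\<lambda>q. enc_bool (q \<in> delta M (qs ! i) a)) qs =
        map (\<lambda>q. enc_bool (q \<in> delta N (rs ! i) a)) rs" for a
    proof -
      have "a \<in> set as"
        using assms(1) by simp
      with e show ?thesis
        unfolding map_eq_conv by (simp add: enc_list_inject)
    qed
    then have "qs ! j \<in> delta M (qs ! i) a \<longleftrightarrow> rs ! j \<in> delta N (rs ! i) a"
      if "j < length qs" for a j
      using that len unfolding list_eq_iff_nth_eq by (simp add: enc_bool_inject)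
    then show ?thesis
      using eq' that len by (simp add: enc_bool_inject)
  qed
  have "r i \<in> states M" for i
  proof (induction i)
    case 0 then show ?case using M(1) r(1) by (simp add: buchi_def)
  next
    case (Suc i) then show ?case using M(1) r(2)[of i] unfolding buchi_def by blast
  qed
  then have "\<forall>i. \<exists>j. j < length qs \<and> qs ! j = r i"
    by (simp add: M(3)[symmetric] in_set_conv_nth)
  then have "\<exists>k. \<forall>i. k i < length qs \<and> qs ! k i = r i"
    by (rule choice)
  then obtain k where k: "\<And>i. k i < length qs" "\<And>i. qs ! k i = r i"
    by blast
  have "rs ! k 0 = initial N"
    using tab[OF k(1)[of 0]] k(2)[of 0] r(1) by simp
  moreover have "rs ! k (Suc i) \<in> delta N (rs ! k i) (w i)" for i
  proof -
    have "qs ! k (Suc i) \<in> delta M (qs ! k i) (w i)"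
      using r(2)[of i] k(2) by simp
    then show ?thesis
      using tab[OF k(1)[of i]] k(1)[of "Suc i"] by blast
  qed
  ultimately have "is_run N w (\<lambda>i. rs ! k i)"
    unfolding is_run_def by blast
  moreover have "\<exists>\<^sub>\<infinity> i. rs ! k i \<in> accepting N"
    using inf tab[OF k(1)] k(2) by simp
  ultimately show "w \<in> language N"
    unfolding language_def by blast
qed

lemma language_eq_if_encodes:
  assumes "set as = UNIV" "encodes as x M" "encodes as x N"
  shows "language M = language N"
proof -
  obtain qs where M: "buchi M" "distinct qs" "set qs = states M" "x = enc_acceptor as qs M"
    using assms(2) unfolding encodes_def by blast
  obtain rs where N: "buchi N" "distinct rs" "set rs = states N" "x = enc_acceptor as rs N"
    using assms(3) unfolding encodes_def by blast
  have eq: "enc_acceptor as qs M = enc_acceptor as rs N"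
    using M(4) N(4) by simp
  show ?thesis
    using language_subset_if_enc_acceptor_eq[OF assms(1) M(1-3) N(1-3) eq]
      language_subset_if_enc_acceptor_eq[OF assms(1) N(1-3) M(1-3) eq[symmetric]]
    by (rule subset_antisym)
qed

lemma subset_oracle_deterministic:
  "set as = UNIV \<Longrightarrow> subset_oracle as L x b \<Longrightarrow> subset_oracle as L x b' \<Longrightarrow> b = b'"
  unfolding subset_oracle_def using language_eq_if_encodes[of as x] by blast

end

theory Submission
  imports Defs
begin

text \<open>
  An infinite word in \<open>language M - L\<close> corresponds to a run of the product of \<open>M\<close> and \<open>T\<close> that visits
  \<open>accepting M\<close> infinitely often and \<open>accepting T\<close> only finitely often. The product of \<open>M\<close> with a
  lasso of constraints on letters and states is deterministic if \<open>M\<close> is, so a restricted query tells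
  whether a counterexample has the form \<open>a\<^sub>1 a\<^sub>2 \<dots>\<close> where each \<open>a\<^sub>i\<close> satisfies its constraint.

  The first letters \<open>y\<close> of the period are found one by one: \<open>y\<close> is kept such that the free letters
  \<open>\<Sigma>\<close> allow for a counterexample in \<open>\<Sigma>\<^sup>i (y \<Sigma>\<^sup>j)\<^sup>\<omega>\<close> for some \<open>i, j \<le> n\<close>. The different rounds
  may use different free letters, but \<open>y\<close> itself is always read along a cycle of the product that avoids
  \<open>accepting T\<close>. The next letter is chosen such that \<open>M\<close> can be forced to be in an accepting
  state as soon as possible, and such positions of \<open>y\<close> are marked. When there are more marked positions
  than states of the product, the same state occurs at two of them, and the infix \<open>v\<close> between them
  gives a counterexample in \<open>\<Sigma>\<^sup>i v\<^sup>\<omega>\<close>, whose first letters are again found one by one. Since \<open>T\<close> is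
  unknown, the bound \<open>n\<close> is increased in every step, and \<open>y\<close> is discarded when it cannot be extended.
\<close>

section \<open>Paths in labelled graphs\<close>

text \<open>Fixing the next letter may lengthen the free part: a refutation may repeat a state of
  the product only after several rounds, and all of them have to be absorbed by the free letters
  after \<open>y\<close>. So \<open>y\<close> can grow without the free part ever vanishing, and the
  period has to be cut out of \<open>y\<close> by the pigeonhole principle. An arbitrary repeated
  state would not do, since the cycle must also meet \<open>accepting M\<close>; hence the marks,
  which are constraints that every query imposes on the run of \<open>M\<close>.

  The invariant \<open>good\<close> speaks of a cycle of the product without any length bound. A
  positive test implies it for every \<open>n\<close>, and it implies a positive test once
  \<open>n \<ge> 2 * S\<close>. Too small a bound only costs time and never lets a wrong
  \<open>y\<close> in. Afterwards the pair of missing marks and distance to the next mark decreases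
  lexicographically, which bounds the number of steps, and with it all lists and queries,
  polynomially in \<open>S\<close>.\<close>

fun path :: "('s \<Rightarrow> 'a \<Rightarrow> 's \<Rightarrow> bool) \<Rightarrow> 's \<Rightarrow> ('a \<times> 's) list \<Rightarrow> 's \<Rightarrow> bool" where
  "path R x [] y \<longleftrightarrow> x = y"
| "path R x ((a, z) # es) y \<longleftrightarrow> R x a z \<and> path R z es y"

lemma path_append:
  "path R x (es @ fs) y \<longleftrightarrow> (\<exists>z. path R x es z \<and> path R z fs y)"
  by (induction es arbitrary: x) auto

lemma path_appendI: "path R x es z \<Longrightarrow> path R z fs y \<Longrightarrow> path R x (es @ fs) y"
  using path_append by metis

lemma path_mono:
  assumes "path R x es y" and "\<And>x a z. R x a z \<Longrightarrow> R' x a z"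
  shows "path R' x es y"
  using assms(1) by (induction es arbitrary: x) (auto simp: assms(2))

lemma path_last: "path R x es y \<Longrightarrow> es \<noteq> [] \<Longrightarrow> snd (last es) = y"
  by (induction R x es y rule: path.induct) auto

lemma path_nth:
  "path R x es y \<Longrightarrow> i < length es \<Longrightarrow> R ((x # map snd es) ! i) (fst (es ! i)) (snd (es ! i))"
  by (induction R x es y arbitrary: i rule: path.induct) (auto simp: nth_Cons split: nat.split)

lemma path_closed:
  assumes "path R x es y" and "x \<in> V" and closed: "\<forall>x \<in> V. \<forall>a z. R x a z \<longrightarrow> z \<in> V"
  shows "\<forall>e \<in> set es. snd e \<in> V" and "y \<in> V"
proof -
  have "(\<forall>e \<in> set es. snd e \<in> V) \<and> y \<in> V"
    using assms(1,2)
  proof (induction es arbitrary: x)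
    case (Cons e es)
    then show ?case
      using closed by (cases e) (auto simp del: split_paired_All split_paired_Ex)
  qed simp
  then show "\<forall>e \<in> set es. snd e \<in> V" and "y \<in> V"
    by simp_all
qed

lemma path_target:
  assumes "path R x es y" and "\<And>x a z. R x a z \<Longrightarrow> S z"
  shows "\<forall>e \<in> set es. S (snd e)"
  using assms(1)
proof (induction es arbitrary: x)
  case (Cons e es)
  then show ?case
    using assms(2) by (cases e) (metis path.simps(2) set_ConsD snd_conv)
qed simp

lemma path_replicate:
  "path R x es x \<Longrightarrow> path R x (concat (replicate k es)) x"
  by (induction k) (auto intro: path_appendI)

lemma path_split_at:
  assumes "path R x es y" and "e \<in> set es"
  obtains fs gs p where "es = fs @ e # gs" "path R x fs p" "R p (fst e) (snd e)"
    "path R (snd e) gs y"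
proof -
  obtain fs gs where es: "es = fs @ e # gs"
    using assms(2) by (meson split_list)
  then show thesis
    using assms(1) that by (cases e) (auto simp: path_append)
qed

text \<open>Entry \<open>i\<close> of a path holds the state after its step, hence the cuts at
  \<open>Suc i\<close> and \<open>Suc j\<close>: the cycle ends with edge \<open>j\<close>.\<close>

lemma path_cycle_between:
  assumes "path R x es y" and "i < j" and "j < length es" and "snd (es ! i) = snd (es ! j)"
  shows "path R x (take (Suc i) es) (snd (es ! i))"
    and "path R (snd (es ! i)) (drop (Suc i) (take (Suc j) es)) (snd (es ! i))"
    and "path R (snd (es ! i)) (drop (Suc j) es) y"
proof -
  have es: "es = take (Suc i) es @ (drop (Suc i) (take (Suc j) es) @ drop (Suc j) es)"
    using assms(2) by (metis Suc_mono append_assoc append_take_drop_id less_imp_le_nat min.absorb1 take_take)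
  then obtain z z' where *: "path R x (take (Suc i) es) z"
    "path R z (drop (Suc i) (take (Suc j) es)) z'" "path R z' (drop (Suc j) es) y"
    using assms(1) by (metis path_append)
  have z: "z = snd (es ! i)"
    using path_last[OF *(1)] assms(2,3) by (cases es) (auto simp: last_conv_nth)
  have "z' = snd (es ! j)"
    using path_last[OF *(2)] assms(2,3) by (auto simp: last_conv_nth)
  with * z assms(4) show "path R x (take (Suc i) es) (snd (es ! i))"
    "path R (snd (es ! i)) (drop (Suc i) (take (Suc j) es)) (snd (es ! i))"
    "path R (snd (es ! i)) (drop (Suc j) es) y"
    by simp_all
qed

text \<open>Cutting out cycles makes the targets of the edges pairwise distinct. The source is not
  counted, so the bound is \<open>card V\<close> and not \<open>card V - 1\<close>.\<close>

lemma short_path: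
  assumes "path R x es y" and V: "x \<in> V" "finite V" "\<forall>x \<in> V. \<forall>a z. R x a z \<longrightarrow> z \<in> V"
  shows "\<exists>fs. path R x fs y \<and> length fs \<le> card V"
  using assms(1)
proof (induction "length es" arbitrary: es rule: less_induct)
  case less
  show ?case
  proof (cases "length es \<le> card V")
    case True
    then show ?thesis using less.prems by blast
  next
    case False
    have "(\<lambda>i. snd (es ! i)) ` {..<length es} \<subseteq> V"
      using path_closed(1)[OF less.prems V(1,3)] by auto
    then have "card ((\<lambda>i. snd (es ! i)) ` {..<length es}) \<le> card V"
      using V(2) by (intro card_mono)
    then have "card ((\<lambda>i. snd (es ! i)) ` {..<length es}) < card {..<length es}"
      using False by simp
    then have "\<not> inj_on (\<lambda>i. snd (es ! i)) {..<length es}"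
      by (rule pigeonhole)
    then obtain i j where ij: "i < j" "j < length es" "snd (es ! i) = snd (es ! j)"
      unfolding inj_on_def by (metis lessThan_iff linorder_neqE_nat)
    have "path R x (take (Suc i) es @ drop (Suc j) es) y"
      using path_cycle_between[OF less.prems ij] by (blast intro: path_appendI)
    moreover have "length (take (Suc i) es @ drop (Suc j) es) < length es"
      using ij by simp
    ultimately show ?thesis
      using less.hyps by blast
  qed
qed


section \<open>Constrained runs\<close>

text \<open>
  An item constrains one step of a run: \<open>Some a\<close> prescribes the letter and \<open>True\<close> requires the
  state that is reached to be accepting.
\<close>

type_synonym 'a item = "'a option \<times> bool"

abbreviation any :: "'a item" where
  "any \<equiv> (None, False)"

definition exactly :: "'a \<times> bool \<Rightarrow> 'a item" where
  "exactly x = (Some (fst x), snd x)"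

definition admits :: "('q, 'a) acceptor \<Rightarrow> 'a item \<Rightarrow> 'a \<Rightarrow> 'q \<Rightarrow> bool" where
  "admits M it a q \<longleftrightarrow> (fst it = None \<or> fst it = Some a) \<and> (snd it \<longrightarrow> q \<in> accepting M)"

text \<open>Item \<open>i\<close> concerns the letter at \<open>i\<close> and the state after it, so
  a mark on the last item of a loop concerns the state in which the next round starts.\<close>

definition refuted :: "('q, 'a) acceptor \<Rightarrow> 'a word set \<Rightarrow> 'a item word \<Rightarrow> bool" where
  "refuted M L I \<longleftrightarrow> (\<exists>w r. is_run M w r \<and> (\<exists>\<^sub>\<infinity> i. r i \<in> accepting M) \<and>
     (\<forall>i. admits M (I i) (w i) (r (Suc i))) \<and> w \<notin> L)"

lemma conc_iter_any: "[] \<frown> [any]\<^sup>\<omega> = (\<lambda>_. any)"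
  by (simp add: fun_eq_iff)

text \<open>One free item, repeated, leaves \<open>M\<close> unconstrained; so the initial query
  about \<open>M\<close> itself is a lasso query as well.\<close>

lemma refuted_any: "refuted M L (\<lambda>_. any) \<longleftrightarrow> \<not> language M \<subseteq> L"
  unfolding refuted_def language_def admits_def by auto

text \<open>The position is read only once, so it can be given the letter of the witness. In a loop,
  different rounds might need different letters.\<close>

lemma refuted_refine_letter:
  assumes "refuted M L ((u @ (None, b) # r) \<frown> I)"
  shows "\<exists>a. refuted M L ((u @ (Some a, b) # r) \<frown> I)"
proof -
  obtain w r' where w: "is_run M w r'" "\<exists>\<^sub>\<infinity> i. r' i \<in> accepting M" "w \<notin> L"
    "\<And>i. admits M (((u @ (None, b) # r) \<frown> I) i) (w i) (r' (Suc i))"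
    using assms unfolding refuted_def by blast
  have "admits M (((u @ (Some (w (length u)), b) # r) \<frown> I) i) (w i) (r' (Suc i))" for i
    using w(4)[of i] by (auto simp: admits_def conc_def nth_append nth_Cons' split: if_splits)
  then show ?thesis
    unfolding refuted_def using w(1-3) by blast
qed

text \<open>Prescribing all letters determines the word; the marks only restrict its run and can be
  forgotten.\<close>

lemma refuted_exactly:
  assumes "refuted M L (map exactly u \<frown> (map exactly v)\<^sup>\<omega>)" and "v \<noteq> []"
  shows "map fst u \<frown> (map fst v)\<^sup>\<omega> \<in> language M - L"
proof -
  obtain w r where w: "is_run M w r" "\<exists>\<^sub>\<infinity> i. r i \<in> accepting M" "w \<notin> L"
    "\<And>i. admits M ((map exactly u \<frown> (map exactly v)\<^sup>\<omega>) i) (w i) (r (Suc i))"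
    using assms unfolding refuted_def by blast
  have "w i = (map fst u \<frown> (map fst v)\<^sup>\<omega>) i" for i
    using w(4)[of i] assms(2) by (auto simp: admits_def conc_def exactly_def)
  then have "w = map fst u \<frown> (map fst v)\<^sup>\<omega>"
    by (rule ext)
  then show ?thesis
    using w unfolding language_def by blast
qed


section \<open>The product of the acceptor with a deterministic acceptor of the language\<close>

locale product =
  fixes M :: "('q, 'a) acceptor" and T :: "('t, 'a) acceptor" and L :: "'a word set"
  assumes M: "buchi M" and T: "buchi T" "deterministic T" and L: "L = language T"
begin

text \<open>The run of \<open>T\<close> is made total by the additional state \<open>None\<close>.\<close>

definition tstep :: "'t option \<Rightarrow> 'a \<Rightarrow> 't option" where
  "tstep t a = (case t of None \<Rightarrow> None | Some p \<Rightarrow>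
     if delta T p a = {} then None else Some (SOME p'. p' \<in> delta T p a))"

primrec trun :: "'a word \<Rightarrow> nat \<Rightarrow> 't option" where
  "trun w 0 = Some (initial T)"
| "trun w (Suc i) = tstep (trun w i) (w i)"

text \<open>\<open>None\<close> counts as safe: a dead run of \<open>T\<close> never visits
  \<open>accepting T\<close> again.\<close>

definition safe :: "'t option \<Rightarrow> bool" where
  "safe t \<longleftrightarrow> t \<notin> Some ` accepting T"

lemma tstep_Some:
  assumes "p \<in> states T" "p' \<in> delta T p a"
  shows "tstep (Some p) a = Some p'"
proof -
  have "delta T p a \<subseteq> states T" "finite (states T)" "card (delta T p a) \<le> Suc 0"
    using T assms(1) unfolding buchi_def deterministic_def by auto
  then have "\<forall>x \<in> delta T p a. \<forall>y \<in> delta T p a. x = y"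
    using card_le_Suc0_iff_eq finite_subset by metis
  then show ?thesis
    using assms(2) someI[of "\<lambda>p'. p' \<in> delta T p a" p'] unfolding tstep_def by auto
qed

lemma tstep_SomeD: "tstep t a = Some p' \<Longrightarrow> \<exists>p. t = Some p \<and> p' \<in> delta T p a"
  unfolding tstep_def by (auto split: option.splits if_splits intro: someI)

lemma trun_states: "trun w i \<in> insert None (Some ` states T)"
proof (induction i)
  case 0
  then show ?case using T(1) by (simp add: buchi_def)
next
  case (Suc i)
  show ?case
  proof (cases "trun w (Suc i)")
    case (Some p')
    then obtain p where "trun w i = Some p" "p' \<in> delta T p (w i)"
      using tstep_SomeD[of "trun w i" "w i" p'] by auto
    moreover from this have "p \<in> states T"
      using Suc by auto
    ultimately have "p' \<in> states T"
      using T(1) unfolding buchi_def by blast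
    then show ?thesis
      using Some by simp
  qed simp
qed

text \<open>By determinism every run of \<open>T\<close> on \<open>w\<close> is
  \<open>trun w\<close>. Non-membership thus becomes a property of this single run, namely being
  safe from some point on, which a product with \<open>M\<close> can track.\<close>

lemma in_L_iff: "w \<in> L \<longleftrightarrow> (\<exists>\<^sub>\<infinity> i. \<not> safe (trun w i))"
proof
  assume "w \<in> L"
  then obtain r where r: "is_run T w r" "\<exists>\<^sub>\<infinity> i. r i \<in> accepting T"
    using L unfolding language_def by blast
  have "trun w i = Some (r i)" for i
  proof (induction i)
    case (Suc i)
    then have "r i \<in> states T"
      using trun_states[of w i] by auto
    then show ?case
      using Suc r(1) tstep_Some unfolding is_run_def by simp
  qed (use r(1) in \<open>simp add: is_run_def\<close>)
  then show "\<exists>\<^sub>\<infinity> i. \<not> safe (trun w i)"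
    using r(2) by (simp add: safe_def inj_image_mem_iff)
next
  assume inf: "\<exists>\<^sub>\<infinity> i. \<not> safe (trun w i)"
  have None: "trun w i = None \<Longrightarrow> trun w (i + j) = None" for i j
    by (induction j) (auto simp: tstep_def)
  have some: "trun w i \<noteq> None" for i
  proof
    assume "trun w i = None"
    moreover obtain j where "j > i" "\<not> safe (trun w j)"
      using inf unfolding INFM_nat by blast
    ultimately show False
      using None[of i "j - i"] by (auto simp: safe_def)
  qed
  define r where "r i = the (trun w i)" for i
  have r: "trun w i = Some (r i)" for i
    using some[of i] by (simp add: r_def)
  have "r (Suc i) \<in> delta T (r i) (w i)" for i
    using tstep_SomeD[of "trun w i" "w i" "r (Suc i)"] r[of i] r[of "Suc i"] by simp
  moreover have "r 0 = initial T"
    by (simp add: r_def)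
  ultimately have "is_run T w r"
    unfolding is_run_def by blast
  moreover have "\<exists>\<^sub>\<infinity> i. r i \<in> accepting T"
    using inf r by (simp add: safe_def inj_image_mem_iff)
  ultimately show "w \<in> L"
    using L unfolding language_def by blast
qed

section \<open>The product graph and its safe edges\<close>

definition step :: "'q \<times> 't option \<Rightarrow> 'a \<Rightarrow> 'q \<times> 't option \<Rightarrow> bool" where
  "step x a z \<longleftrightarrow> fst z \<in> delta M (fst x) a \<and> snd z = tstep (snd x) a"

text \<open>Only the target has to be safe. On a cycle every state is a target.\<close>

definition safe_step :: "'q \<times> 't option \<Rightarrow> 'a \<Rightarrow> 'q \<times> 't option \<Rightarrow> bool" where
  "safe_step x a z \<longleftrightarrow> step x a z \<and> safe (snd z)"

definition init :: "'q \<times> 't option" where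
  "init = (initial M, Some (initial T))"

definition V :: "('q \<times> 't option) set" where
  "V = states M \<times> insert None (Some ` states T)"

text \<open>The \<open>Suc\<close> accounts for the dead state \<open>None\<close> of
  \<open>T\<close>.\<close>

definition S :: nat where
  "S = card (states M) * Suc (card (states T))"

lemma finite_V: "finite V"
  using M T(1) unfolding V_def buchi_def by simp

lemma card_V: "card V = S"
proof -
  have "card (insert None (Some ` states T)) = Suc (card (states T))"
    using T(1) unfolding buchi_def by (subst card_insert_disjoint) (auto simp: card_image)
  then show ?thesis
    unfolding V_def S_def by (simp add: card_cartesian_product)
qed

lemma init_V: "init \<in> V"
  using M T(1) unfolding init_def V_def buchi_def by simp

lemma step_V: "\<forall>x \<in> V. \<forall>a z. step x a z \<longrightarrow> z \<in> V"
proof (intro ballI allI impI)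
  fix x a z assume "x \<in> V" "step x a z"
  then have x: "fst x \<in> states M" "snd x \<in> insert None (Some ` states T)"
    and z: "fst z \<in> delta M (fst x) a" "snd z = tstep (snd x) a"
    unfolding V_def step_def by (auto simp: mem_Times_iff)
  have "fst z \<in> states M"
    using M x(1) z(1) unfolding buchi_def by blast
  moreover have "snd z \<in> insert None (Some ` states T)"
  proof (cases "snd z")
    case (Some p')
    then obtain p where "snd x = Some p" "p' \<in> delta T p a"
      using tstep_SomeD z(2) by metis
    moreover from this have "p \<in> states T"
      using x(2) by auto
    ultimately show ?thesis
      using Some T(1) unfolding buchi_def by blast
  qed simp
  ultimately show "z \<in> V"
    unfolding V_def by (simp add: mem_Times_iff)
qed

lemma safe_step_V: "\<forall>x \<in> V. \<forall>a z. safe_step x a z \<longrightarrow> z \<in> V"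
  using step_V unfolding safe_step_def by blast

lemma safe_path_path: "path safe_step x es y \<Longrightarrow> path step x es y"
  by (erule path_mono) (simp add: safe_step_def)

lemma path_V: "x \<in> V \<Longrightarrow> path step x es y \<Longrightarrow> y \<in> V"
  using path_closed(2)[OF _ _ step_V] .

section \<open>Refutations by lassos correspond to safe cycles of the product\<close>

abbreviation adm :: "'a item list \<Rightarrow> ('a \<times> 'q \<times> 't option) list \<Rightarrow> bool" where
  "adm its es \<equiv> list_all2 (\<lambda>it e. admits M it (fst e) (fst (snd e))) its es"

abbreviation visits :: "('a \<times> 'q \<times> 't option) list \<Rightarrow> bool" where
  "visits es \<equiv> \<exists>e \<in> set es. fst (snd e) \<in> accepting M"

lemma adm_any: "adm (replicate n any) es \<longleftrightarrow> length es = n"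
  by (auto simp: list_all2_conv_all_nth admits_def)

text \<open>
  The cycle can be prolonged by another round, so requiring the accepting state in the closing part
  \<open>fs\<close> is no restriction.
\<close>

definition good :: "'a item list \<Rightarrow> bool" where
  "good its \<longleftrightarrow> (\<exists>ds es fs x y. path step init ds x \<and> path safe_step x es y \<and> adm its es \<and>
     path safe_step y fs x \<and> visits fs)"

lemma goodI:
  "path step init ds x \<Longrightarrow> path safe_step x es y \<Longrightarrow> adm its es \<Longrightarrow> path safe_step y fs x \<Longrightarrow>
    visits fs \<Longrightarrow> good its"
  unfolding good_def by blast

text \<open>Going round \<open>es\<close> forever visits \<open>accepting M\<close> in every round,
  whereas the component of \<open>T\<close> is safe from the first round on.\<close>

lemma refuted_lasso:
  assumes d: "path step init ds x" "adm s ds"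
    and e: "path safe_step x es x" "adm l es" "visits es"
  shows "refuted M L (s \<frown> l\<^sup>\<omega>)"
proof -
  have ne: "es \<noteq> []" "l \<noteq> []"
    using e(2,3) by auto
  have len: "length s = length ds" "length l = length es"
    using d(2) e(2) by (auto simp: list_all2_lengthD)
  define W where "W = ds \<frown> es\<^sup>\<omega>"
  define \<rho> where "\<rho> i = (case i of 0 \<Rightarrow> init | Suc j \<Rightarrow> snd (W j))" for i
  define w where "w i = fst (W i)" for i
  \<comment> \<open>Every position lies in some finite prefix of \<open>ds\<close> and
    \<open>k\<close> rounds, so the edges of the infinite run can be read off a finite path.\<close>
  have unroll: "W = (ds @ concat (replicate k es)) \<frown> es\<^sup>\<omega>" for k
  proof (induction k)
    case (Suc k)
    have "replicate (Suc k) es = replicate k es @ [es]"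
      by (simp add: replicate_append_same)
    then show ?case
      using Suc iter_unroll[of es] ne(1) by (metis append_assoc append_Nil2 concat.simps concat_append
          conc_conc length_greater_0_conv)
  qed (simp add: W_def)
  have step: "step (\<rho> i) (w i) (\<rho> (Suc i))" for i
  proof -
    let ?p = "ds @ concat (replicate (Suc i) es)"
    have "length (concat (replicate k es)) = k * length es" for k
      by (induction k) auto
    moreover have "Suc i * 1 \<le> Suc i * length es"
      using ne(1) by (intro mult_le_mono) (auto simp: Suc_le_eq)
    ultimately have i: "i < length ?p"
      by simp
    have W: "W j = ?p ! j" if "j \<le> i" for j
      using unroll[of "Suc i"] i that by (metis conc_fst le_less_trans)
    have p: "path step init ?p x"
      using d(1) path_replicate[OF safe_path_path[OF e(1)]] by (blast intro: path_appendI)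
    have "(init # map snd ?p) ! i = \<rho> i"
    proof (cases i)
      case (Suc j)
      then show ?thesis
        using W[of j] i nth_map[of j ?p snd] by (simp only: \<rho>_def nat.case nth_Cons_Suc)
    qed (simp add: \<rho>_def)
    then show ?thesis
      using path_nth[OF p i] W[of i] unfolding w_def \<rho>_def by simp
  qed
  have \<rho>: "\<rho> 0 = init" "\<And>i. \<rho> (Suc i) = snd (W i)"
    by (auto simp: \<rho>_def)
  have t: "snd (\<rho> i) = trun w i" for i
    by (induction i) (use step in \<open>auto simp: \<rho>(1) init_def step_def\<close>)
  have "is_run M w (\<lambda>i. fst (\<rho> i))"
    using step \<rho>(1) unfolding is_run_def step_def init_def by simp
  moreover have "\<exists>\<^sub>\<infinity> i. fst (\<rho> i) \<in> accepting M"
    unfolding INFM_nat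
  proof
    fix n
    obtain j where j: "j < length es" "fst (snd (es ! j)) \<in> accepting M"
      using e(3) by (auto simp: in_set_conv_nth)
    have "W (length ds + (j + n * length es)) = es ! j"
      using j(1) ne(1) unfolding W_def by simp
    then have "fst (\<rho> (Suc (length ds + (j + n * length es)))) \<in> accepting M"
      using j(2) \<rho>(2) by simp
    moreover have "n \<le> n * length es"
      using ne(1) by (cases es) auto
    then have "n < Suc (length ds + (j + n * length es))"
      by linarith
    ultimately show "\<exists>k > n. fst (\<rho> k) \<in> accepting M"
      by blast
  qed
  moreover have "admits M ((s \<frown> l\<^sup>\<omega>) i) (w i) (fst (\<rho> (Suc i)))" for i
    using d(2) e(2) len ne unfolding w_def \<rho>(2) W_def
    by (auto simp: list_all2_conv_all_nth conc_def)
  moreover have "w \<notin> L"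
  proof -
    have "safe (trun w i)" if "i > length ds" for i
    proof -
      obtain j where j: "i = Suc j" "\<not> j < length ds"
        using \<open>i > length ds\<close> by (cases i) auto
      then have "W j \<in> set es"
        using ne(1) unfolding W_def by simp
      moreover have "\<forall>e \<in> set es. safe (snd (snd e))"
        using path_target[OF e(1), of "\<lambda>z. safe (snd z)"] by (simp add: safe_step_def)
      ultimately show ?thesis
        using t[of i] \<rho>(2) j(1) by auto
    qed
    then show ?thesis
      unfolding in_L_iff INFM_nat by blast
  qed
  ultimately show ?thesis
    unfolding refuted_def by blast
qed

text \<open>Among the late starts of rounds some state \<open>x\<close> of the product recurs
  infinitely often. One round from \<open>x\<close> reads \<open>l\<close>; a later return to
  \<open>x\<close>, possibly many rounds afterwards, provides the closing part.\<close>

lemma good_if_refuted: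
  assumes "refuted M L (s \<frown> l\<^sup>\<omega>)" and "l \<noteq> []"
  shows "good l"
proof -
  obtain w r where run: "is_run M w r" and inf: "\<exists>\<^sub>\<infinity> i. r i \<in> accepting M" and "w \<notin> L"
    and adm: "\<And>i. admits M ((s \<frown> l\<^sup>\<omega>) i) (w i) (r (Suc i))"
    using assms unfolding refuted_def by blast
  define \<rho> where "\<rho> i = (r i, trun w i)" for i
  have step: "step (\<rho> i) (w i) (\<rho> (Suc i))" for i
    using run unfolding step_def \<rho>_def is_run_def by simp
  have \<rho>0: "\<rho> 0 = init"
    using run unfolding \<rho>_def init_def is_run_def by simp
  obtain N where N: "\<And>i. i > N \<Longrightarrow> safe (trun w i)"
    using \<open>w \<notin> L\<close> unfolding in_L_iff INFM_nat by blast
  define seg where "seg i j = map (\<lambda>n. (w n, \<rho> (Suc n))) [i..<j]" for i j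
  have seg: "path step (\<rho> i) (seg i j) (\<rho> j)" if "i \<le> j" for i j
    using that
  proof (induction j rule: dec_induct)
    case (step j)
    then show ?case
      using \<open>step (\<rho> j) (w j) (\<rho> (Suc j))\<close> by (auto simp: seg_def intro!: path_appendI)
  qed (simp add: seg_def)
  have safe_seg: "path safe_step (\<rho> i) (seg i j) (\<rho> j)" if "i \<le> j" "i \<ge> N" for i j
    using that
  proof (induction j rule: dec_induct)
    case (step j)
    then have "safe_step (\<rho> j) (w j) (\<rho> (Suc j))"
      using \<open>step (\<rho> j) (w j) (\<rho> (Suc j))\<close> N[of "Suc j"] by (simp add: safe_step_def \<rho>_def)
    then show ?case
      using step by (auto simp: seg_def intro!: path_appendI)
  qed (simp add: seg_def)
  \<comment> \<open>Starts of rounds; the summand \<open>N\<close> places them where the run of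
    \<open>T\<close> is already safe.\<close>
  define p where "p k = length s + (N + k) * length l" for k
  have pN: "p k \<ge> N" "p k \<ge> k" for k
  proof -
    have "N + k \<le> (N + k) * length l"
      using assms(2) by (cases l) auto
    then have "N + k \<le> p k"
      unfolding p_def by linarith
    then show "p k \<ge> N" "p k \<ge> k"
      by simp_all
  qed
  have inV: "\<rho> i \<in> V" for i
    using path_V[OF init_V] seg[of 0 i] \<rho>0 by auto
  have "\<exists>x \<in> V. infinite {k \<in> UNIV. \<rho> (p k) = x}"
    by (rule pigeonhole_infinite_rel) (use finite_V inV in auto)
  then obtain x where x: "infinite {k. \<rho> (p k) = x}"
    by auto
  then obtain k where k: "\<rho> (p k) = x"
    using not_finite_existsD by blast
  define q where "q = p k + length l"
  \<comment> \<open>The visit is chosen beyond the first round and the return beyond the visit, so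
    that the visit lies on the closing part.\<close>
  obtain f where f: "f > q" "r f \<in> accepting M"
    using inf unfolding INFM_nat by blast
  obtain k' where k': "k' > f" "\<rho> (p k') = x"
    using x unfolding infinite_nat_iff_unbounded by blast
  have fk: "f < p k'"
    using pN(2)[of k'] k'(1) by simp
  have "path step init (seg 0 (p k)) x"
    using seg[of 0 "p k"] \<rho>0 k by simp
  moreover have "path safe_step x (seg (p k) q) (\<rho> q)"
    using safe_seg[of "p k" q] pN(1)[of k] k unfolding q_def by simp
  moreover have "adm l (seg (p k) q)"
    unfolding list_all2_conv_all_nth
  proof (intro conjI allI impI)
    show len: "length l = length (seg (p k) q)"
      unfolding seg_def q_def by simp
    fix j assume "j < length l"
    moreover have "(s \<frown> l\<^sup>\<omega>) (p k + j) = l ! j"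
      using \<open>j < length l\<close> assms(2) by (simp add: p_def conc_def)
    ultimately show "admits M (l ! j) (fst (seg (p k) q ! j)) (fst (snd (seg (p k) q ! j)))"
      using adm[of "p k + j"] unfolding seg_def q_def by (simp add: \<rho>_def)
  qed
  moreover have "path safe_step (\<rho> q) (seg q (p k')) x"
    using safe_seg[of q "p k'"] k'(2) f(1) fk pN(1)[of k] unfolding q_def by simp
  moreover have "visits (seg q (p k'))"
  proof
    show "(w (f - 1), \<rho> f) \<in> set (seg q (p k'))"
      using f(1) fk by (auto simp: seg_def intro!: image_eqI[of _ _ "f - 1"])
    show "fst (snd (w (f - 1), \<rho> f)) \<in> accepting M"
      using f(2) by (simp add: \<rho>_def)
  qed
  ultimately show ?thesis
    by (rule goodI)
qed

text \<open>The path of the dropped items is added to the closing part. This is how the padding and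
  the rest of the goal are forgotten after a successful test.\<close>

lemma good_prefix:
  assumes "good (its @ its')"
  shows "good its"
proof -
  obtain ds es fs x y where *: "path step init ds x" "path safe_step x es y" "adm (its @ its') es"
    "path safe_step y fs x" "visits fs"
    using assms unfolding good_def by blast
  obtain es1 es2 where es: "es = es1 @ es2" "adm its es1"
    using *(3) unfolding list_all2_append1 by blast
  then obtain z where "path safe_step x es1 z" "path safe_step z es2 y"
    using *(2) path_append[of safe_step x es1 es2 y] by blast
  with * es show ?thesis
    by (intro goodI[of ds x es1 z its "es2 @ fs"]) (auto intro: path_appendI)
qed

text \<open>A single edge of a single path reads this item, so its letter can be fixed. For
  \<open>refuted\<close> with repeated items, different rounds might need different letters.\<close>

lemma good_refine_letter:
  assumes "good (its @ (None, b) # its')"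
  shows "\<exists>a. good (its @ (Some a, b) # its')"
proof -
  obtain ds es fs x y where *: "path step init ds x" "path safe_step x es y"
    "adm (its @ (None, b) # its') es" "path safe_step y fs x" "visits fs"
    using assms unfolding good_def by blast
  obtain es1 e es2 where es: "es = es1 @ e # es2" "adm its es1" "adm its' es2"
    "admits M (None, b) (fst e) (fst (snd e))"
    using *(3) by (auto simp: list_all2_append1 list_all2_Cons1)
  then have "adm (its @ (Some (fst e), b) # its') es"
    by (auto simp: admits_def intro: list_all2_appendI)
  with * show ?thesis
    using goodI by blast
qed

text \<open>The way to the visit on the closing part is free and can be shortened to
  \<open>S\<close> steps. A whole further round is then appended, since \<open>f2\<close> alone
  might contain no visit.\<close>

lemma good_reach_accepting:
  assumes "good its"
  shows "\<exists>d \<le> S. good (its @ replicate d any @ [(None, True)])"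
proof -
  obtain ds es fs x y where *: "path step init ds x" "path safe_step x es y" "adm its es"
    "path safe_step y fs x" "visits fs"
    using assms unfolding good_def by blast
  obtain e where e: "e \<in> set fs" "fst (snd e) \<in> accepting M"
    using *(5) by blast
  obtain f1 f2 p where f: "fs = f1 @ e # f2" "path safe_step y f1 p"
    "safe_step p (fst e) (snd e)" "path safe_step (snd e) f2 x"
    using path_split_at[OF *(4) e(1)] by metis
  have "y \<in> V"
    using path_V[OF path_V[OF init_V *(1)] safe_path_path[OF *(2)]] .
  then obtain g where g: "path safe_step y g p" "length g \<le> S"
    using short_path[OF f(2) _ finite_V safe_step_V] card_V by auto
  have pe: "path safe_step p [e] (snd e)"
    using f(3) by (cases e) simp
  have "path safe_step x (es @ g @ [e]) (snd e)"
    using *(2) g(1) pe by (blast intro: path_appendI)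
  moreover have "adm (its @ replicate (length g) any @ [(None, True)]) (es @ g @ [e])"
    using *(3) e(2) adm_any by (auto intro!: list_all2_appendI simp: admits_def)
  moreover have "path safe_step (snd e) (f2 @ es @ f1 @ [e] @ f2) x"
    using f(2,4) pe *(2) by (blast intro: path_appendI)
  moreover have "visits (f2 @ es @ f1 @ [e] @ f2)"
    using e(2) by simp
  ultimately have "good (its @ replicate (length g) any @ [(None, True)])"
    by (rule goodI[OF *(1)])
  then show ?thesis
    using g(2) by blast
qed

text \<open>All that surrounds \<open>its\<close> is unconstrained and may be replaced by shortest
  paths: one from \<open>init\<close> to \<open>x\<close>, and two for closing the cycle, from
  \<open>y\<close> to an accepting state and from there to \<open>x\<close>. Hence \<open>S\<close>
  and \<open>2 * S\<close>.\<close>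

lemma refuted_if_good:
  assumes "good its" and "its \<noteq> []"
  shows "\<exists>i \<le> S. \<exists>j \<le> 2 * S. refuted M L (replicate i any \<frown> (its @ replicate j any)\<^sup>\<omega>)"
proof -
  obtain ds es fs x y where *: "path step init ds x" "path safe_step x es y" "adm its es"
    "path safe_step y fs x" "visits fs"
    using assms unfolding good_def by blast
  obtain e where e: "e \<in> set fs" "fst (snd e) \<in> accepting M"
    using *(5) by blast
  obtain f1 f2 p where f: "fs = f1 @ e # f2" "path safe_step y f1 p"
    "safe_step p (fst e) (snd e)" "path safe_step (snd e) f2 x"
    using path_split_at[OF *(4) e(1)] by metis
  have pe: "path safe_step p [e] (snd e)"
    using f(3) by (cases e) simp
  have yz: "path safe_step y (f1 @ [e]) (snd e)"
    using f(2) pe by (blast intro: path_appendI)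
  have V: "x \<in> V" "y \<in> V" "snd e \<in> V"
    using path_V[OF init_V *(1)] path_V[OF _ safe_path_path[OF *(2)]]
      path_V[OF _ safe_path_path[OF yz]] by auto
  obtain ds' where ds': "path step init ds' x" "length ds' \<le> S"
    using short_path[OF *(1) init_V finite_V step_V] card_V by auto
  obtain g1 where g1: "path safe_step y g1 (snd e)" "length g1 \<le> S"
    using short_path[OF yz V(2) finite_V safe_step_V] card_V by auto
  obtain g2 where g2: "path safe_step (snd e) g2 x" "length g2 \<le> S"
    using short_path[OF f(4) V(3) finite_V safe_step_V] card_V by auto
  \<comment> \<open>\<open>g1\<close> is empty if \<open>y\<close> already is the chosen accepting
    state. The visit is then the last edge of \<open>es\<close>, which exists because
    \<open>its\<close> is nonempty.\<close>
  have "es @ g1 \<noteq> []"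
    using *(3) assms(2) by auto
  moreover have "path safe_step x (es @ g1) (snd e)"
    using *(2) g1(1) by (blast intro: path_appendI)
  ultimately have "snd (last (es @ g1)) = snd e" "last (es @ g1) \<in> set (es @ g1)"
    using path_last[of safe_step x "es @ g1" "snd e"] last_in_set[of "es @ g1"] by blast+
  then have "visits (es @ g1 @ g2)"
    using e(2) by (metis Un_iff append_assoc set_append)
  moreover have "path safe_step x (es @ g1 @ g2) x"
    using *(2) g1(1) g2(1) by (blast intro: path_appendI)
  moreover have "adm (its @ replicate (length g1 + length g2) any) (es @ g1 @ g2)"
    using *(3) adm_any[of "length g1 + length g2" "g1 @ g2"] by (auto intro: list_all2_appendI)
  ultimately have "refuted M L (replicate (length ds') any \<frown>
      (its @ replicate (length g1 + length g2) any)\<^sup>\<omega>)"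
    using refuted_lasso[OF ds'(1)] adm_any by blast
  moreover have "length g1 + length g2 \<le> 2 * S"
    using g1(2) g2(2) by simp
  ultimately show ?thesis
    using ds'(2) by blast
qed

text \<open>Two marked positions must reach the same state of the product, which closes a cycle.\<close>

lemma refuted_infix:
  assumes "good its" and "card {j. j < length its \<and> snd (its ! j)} > S"
  shows "\<exists>us vs ws. \<exists>i \<le> S. its = us @ vs @ ws \<and> vs \<noteq> [] \<and>
    refuted M L (replicate i any \<frown> vs\<^sup>\<omega>)"
proof -
  obtain ds es fs x y where *: "path step init ds x" "path safe_step x es y" "adm its es"
    "path safe_step y fs x" "visits fs"
    using assms unfolding good_def by blast
  let ?J = "{j. j < length its \<and> snd (its ! j)}"
  have x: "x \<in> V"
    using path_V[OF init_V *(1)] .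
  have len: "length its = length es"
    using *(3) by (rule list_all2_lengthD)
  have "(\<lambda>j. snd (es ! j)) ` ?J \<subseteq> V"
    using path_closed(1)[OF *(2) x safe_step_V] len by auto
  then have "card ((\<lambda>j. snd (es ! j)) ` ?J) \<le> S"
    using card_mono[OF finite_V] card_V by auto
  then have "\<not> inj_on (\<lambda>j. snd (es ! j)) ?J"
    using assms(2) by (intro pigeonhole) simp
  then obtain j' k' where jk': "j' \<in> ?J" "k' \<in> ?J" "j' \<noteq> k'" "snd (es ! j') = snd (es ! k')"
    unfolding inj_on_def by blast
  define j k where "j = min j' k'" and "k = max j' k'"
  have jk: "j \<in> ?J" "k \<in> ?J" "j < k" "snd (es ! j) = snd (es ! k)"
    using jk' unfolding j_def k_def by (auto simp: min_def max_def)
  define vs where "vs = drop (Suc j) (take (Suc k) its)"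
  define cs where "cs = drop (Suc j) (take (Suc k) es)"
  have k: "k < length es"
    using jk(2) len by simp
  note cycle = path_cycle_between[OF *(2) jk(3) k jk(4)]
  obtain ds' where ds': "path step init ds' (snd (es ! j))" "length ds' \<le> S"
    using short_path[OF path_appendI[OF *(1) safe_path_path[OF cycle(1)]] init_V finite_V step_V]
      card_V by auto
  have last: "last cs = es ! k" "cs \<noteq> []"
    using jk(3) k unfolding cs_def by (auto simp: last_conv_nth)
  \<comment> \<open>The cycle ends with edge \<open>k\<close>, whose mark supplies the visit needed
    for \<open>refuted_lasso\<close>.\<close>
  have "fst (snd (es ! k)) \<in> accepting M"
    using *(3) jk(2) by (auto simp: list_all2_conv_all_nth admits_def)
  then have "visits cs"
    using last by (metis last_in_set)
  moreover have "adm vs cs"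
    using *(3) unfolding vs_def cs_def by (intro list_all2_dropI list_all2_takeI)
  ultimately have "refuted M L (replicate (length ds') any \<frown> vs\<^sup>\<omega>)"
    using refuted_lasso[OF ds'(1)] cycle(2) adm_any unfolding cs_def by blast
  moreover have "its = take (Suc j) its @ vs @ drop (Suc k) its"
    unfolding vs_def using jk(3)
    by (metis Suc_mono append_assoc append_take_drop_id less_imp_le_nat min.absorb1 take_take)
  moreover have "vs \<noteq> []"
    using last(2) len unfolding vs_def cs_def by auto
  ultimately show ?thesis
    using ds'(2) by blast
qed

end


section \<open>Acceptors for constrained runs\<close>

definition lasso_next :: "'i list \<Rightarrow> 'i list \<Rightarrow> nat \<Rightarrow> nat" where
  "lasso_next s l c = (if Suc c < length (s @ l) then Suc c else length s)"

definition lasso :: "('q, 'a) acceptor \<Rightarrow> 'a item list \<Rightarrow> 'a item list \<Rightarrow> (nat \<times> 'q, 'a) acceptor" where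
  "lasso M s l = \<lparr>states = {..<length (s @ l)} \<times> states M, initial = (0, initial M),
     delta = (\<lambda>(c, p) a. {(c', q). c' = lasso_next s l c \<and> q \<in> delta M p a \<and>
       admits M ((s @ l) ! c) a q}),
     accepting = {..<length (s @ l)} \<times> accepting M\<rparr>"

lemma buchi_lasso:
  assumes "buchi M" and "l \<noteq> []"
  shows "buchi (lasso M s l)"
proof -
  have "lasso_next s l c < length (s @ l)" for c
    using assms(2) by (simp add: lasso_next_def)
  then show ?thesis
    using assms unfolding buchi_def lasso_def by auto
qed

text \<open>The next position is a function of the current one, and the constraints only delete
  successors.\<close>

lemma deterministic_lasso:
  assumes "buchi M" and "deterministic M"
  shows "deterministic (lasso M s l)"
  unfolding deterministic_def
proof (intro ballI allI)
  fix x a assume "x \<in> states (lasso M s l)"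
  then obtain c p where x: "x = (c, p)" "p \<in> states M"
    by (auto simp: lasso_def)
  have fin: "finite (delta M p a)"
    using assms(1) x(2) finite_subset unfolding buchi_def by blast
  have "delta (lasso M s l) x a \<subseteq> {lasso_next s l c} \<times> delta M p a"
    using x(1) by (auto simp: lasso_def)
  then have "card (delta (lasso M s l) x a) \<le> card ({lasso_next s l c} \<times> delta M p a)"
    using fin by (intro card_mono) auto
  also have "\<dots> \<le> 1"
    using assms(2) x(2) unfolding deterministic_def by (simp add: card_cartesian_product)
  finally show "card (delta (lasso M s l) x a) \<le> 1" .
qed

primrec lasso_pos :: "'i list \<Rightarrow> 'i list \<Rightarrow> nat \<Rightarrow> nat" where
  "lasso_pos s l 0 = 0"
| "lasso_pos s l (Suc i) = lasso_next s l (lasso_pos s l i)"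

lemma lasso_pos_eq:
  assumes "l \<noteq> []"
  shows "lasso_pos s l i = (if i < length s then i else length s + (i - length s) mod length l)"
proof (induction i)
  case (Suc i)
  have "length l > 0"
    using assms by simp
  show ?case
  proof (cases "i < length s")
    case True
    with Suc \<open>length l > 0\<close> show ?thesis
      by (auto simp: lasso_next_def not_less)
  next
    case False
    define m where "m = (i - length s) mod length l"
    have "m < length l" "Suc (i - length s) mod length l = (if Suc m = length l then 0 else Suc m)"
      using \<open>length l > 0\<close> by (auto simp: m_def mod_Suc)
    with False Suc show ?thesis
      unfolding m_def[symmetric] by (auto simp: lasso_next_def Suc_diff_le)
  qed
qed (use assms in auto)

lemma conc_iter_pos:
  assumes "l \<noteq> []"
  shows "(s \<frown> l\<^sup>\<omega>) i = (s @ l) ! lasso_pos s l i" and "lasso_pos s l i < length (s @ l)"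
  using assms by (auto simp: lasso_pos_eq conc_def nth_append)

text \<open>The first component of a run is forced to be \<open>lasso_pos s l\<close>, so the second
  is a run of \<open>M\<close> that obeys the repeated items.\<close>

lemma language_lasso:
  assumes "l \<noteq> []"
  shows "language (lasso M s l) \<subseteq> L \<longleftrightarrow> \<not> refuted M L (s \<frown> l\<^sup>\<omega>)"
proof -
  have "w \<in> language (lasso M s l) \<longleftrightarrow> (\<exists>r. is_run M w r \<and> (\<exists>\<^sub>\<infinity> i. r i \<in> accepting M) \<and>
      (\<forall>i. admits M ((s \<frown> l\<^sup>\<omega>) i) (w i) (r (Suc i))))" for w
  proof
    assume "w \<in> language (lasso M s l)"
    then obtain \<rho> where \<rho>: "is_run (lasso M s l) w \<rho>" "\<exists>\<^sub>\<infinity> i. \<rho> i \<in> accepting (lasso M s l)"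
      unfolding language_def by blast
    have step: "fst (\<rho> (Suc i)) = lasso_next s l (fst (\<rho> i)) \<and>
        snd (\<rho> (Suc i)) \<in> delta M (snd (\<rho> i)) (w i) \<and>
        admits M ((s @ l) ! fst (\<rho> i)) (w i) (snd (\<rho> (Suc i)))" for i
    proof -
      have "\<rho> (Suc i) \<in> delta (lasso M s l) (fst (\<rho> i), snd (\<rho> i)) (w i)"
        using \<rho>(1) unfolding is_run_def by simp
      then show ?thesis
        by (cases "\<rho> i") (auto simp: lasso_def)
    qed
    have fst: "fst (\<rho> i) = lasso_pos s l i" for i
      by (induction i) (use \<rho>(1) step in \<open>auto simp: is_run_def lasso_def\<close>)
    have "is_run M w (\<lambda>i. snd (\<rho> i))"
      using \<rho>(1) step unfolding is_run_def by (simp add: lasso_def)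
    moreover have "\<exists>\<^sub>\<infinity> i. snd (\<rho> i) \<in> accepting M"
      using \<rho>(2) by (rule INFM_mono) (auto simp: lasso_def)
    moreover have "\<forall>i. admits M ((s \<frown> l\<^sup>\<omega>) i) (w i) (snd (\<rho> (Suc i)))"
      using step fst conc_iter_pos[OF assms] by simp
    ultimately show "\<exists>r. is_run M w r \<and> (\<exists>\<^sub>\<infinity> i. r i \<in> accepting M) \<and>
      (\<forall>i. admits M ((s \<frown> l\<^sup>\<omega>) i) (w i) (r (Suc i)))"
      by blast
  next
    assume "\<exists>r. is_run M w r \<and> (\<exists>\<^sub>\<infinity> i. r i \<in> accepting M) \<and>
      (\<forall>i. admits M ((s \<frown> l\<^sup>\<omega>) i) (w i) (r (Suc i)))"
    then obtain r where r: "is_run M w r" "\<exists>\<^sub>\<infinity> i. r i \<in> accepting M"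
      "\<And>i. admits M ((s \<frown> l\<^sup>\<omega>) i) (w i) (r (Suc i))"
      by blast
    let ?\<rho> = "\<lambda>i. (lasso_pos s l i, r i)"
    have "is_run (lasso M s l) w ?\<rho>"
      using r(1,3) conc_iter_pos[OF assms] unfolding is_run_def lasso_def by simp
    moreover have "\<exists>\<^sub>\<infinity> i. ?\<rho> i \<in> accepting (lasso M s l)"
      using r(2) by (rule INFM_mono) (use conc_iter_pos(2)[OF assms] in \<open>auto simp: lasso_def\<close>)
    ultimately show "w \<in> language (lasso M s l)"
      unfolding language_def by blast
  qed
  then show ?thesis
    unfolding refuted_def by blast
qed


section \<open>Encodings\<close>

text \<open>The oracle expects states in \<open>nat\<close>, while those of a lasso are pairs. As
  the encoding hides names, renumbering keeps the tree.\<close>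

definition renumber :: "'q list \<Rightarrow> ('q, 'a) acceptor \<Rightarrow> (nat, 'a) acceptor" where
  "renumber qs N = \<lparr>states = {..<length qs},
     initial = (SOME i. i < length qs \<and> qs ! i = initial N),
     delta = (\<lambda>i a. {j. j < length qs \<and> qs ! j \<in> delta N (qs ! i) a}),
     accepting = {j. j < length qs \<and> qs ! j \<in> accepting N}\<rparr>"

lemma renumber:
  assumes N: "buchi N" "distinct qs" "set qs = states N"
  shows "buchi (renumber qs N)"
    and "enc_acceptor as [0..<length qs] (renumber qs N) = enc_acceptor as qs N"
    and "deterministic N \<Longrightarrow> deterministic (renumber qs N)"
proof -
  have "initial N \<in> set qs"
    using N unfolding buchi_def by blast
  then have "\<exists>i. i < length qs \<and> qs ! i = initial N"
    by (simp add: in_set_conv_nth)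
  then have init: "initial (renumber qs N) < length qs" "qs ! initial (renumber qs N) = initial N"
    using someI_ex[of "\<lambda>i. i < length qs \<and> qs ! i = initial N"] by (simp_all add: renumber_def)
  then have init_iff: "i = initial (renumber qs N) \<longleftrightarrow> qs ! i = initial N" if "i < length qs" for i
    using init nth_eq_iff_index_eq[OF N(2) that init(1)] by auto
  show "buchi (renumber qs N)"
    using init(1) unfolding buchi_def by (auto simp: renumber_def)
  have upt: "map f [0..<length qs] = map g qs" if "\<And>i. i < length qs \<Longrightarrow> f i = g (qs ! i)"
    for f :: "nat \<Rightarrow> tree" and g
    using that by (intro nth_equalityI) simp_all
  have "map (\<lambda>j. enc_bool (j \<in> delta (renumber qs N) i a)) [0..<length qs] =
      map (\<lambda>q. enc_bool (q \<in> delta N (qs ! i) a)) qs" for i a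
    by (rule upt) (simp add: renumber_def)
  then show "enc_acceptor as [0..<length qs] (renumber qs N) = enc_acceptor as qs N"
    unfolding enc_acceptor_def by (intro arg_cong[of _ _ enc_list] upt)
      (simp add: init_iff, simp add: renumber_def)
  assume det: "deterministic N"
  have "card (delta (renumber qs N) i a) \<le> 1" if "i < length qs" for i a
  proof -
    have q: "qs ! i \<in> states N"
      using that N(3) nth_mem by blast
    then have fin: "finite (delta N (qs ! i) a)"
      using N(1) finite_subset unfolding buchi_def by blast
    have "inj_on ((!) qs) (delta (renumber qs N) i a)"
      using nth_eq_iff_index_eq[OF N(2)] by (auto simp: inj_on_def renumber_def)
    then have "card (delta (renumber qs N) i a) \<le> card (delta N (qs ! i) a)"
      by (rule card_inj_on_le) (auto simp: renumber_def fin)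
    also have "\<dots> \<le> 1"
      using det q unfolding deterministic_def by blast
    finally show ?thesis .
  qed
  then show "deterministic (renumber qs N)"
    unfolding deterministic_def by (simp add: renumber_def)
qed

lemma encodes_renumber:
  assumes "buchi N" "distinct qs" "set qs = states N"
  shows "encodes as (enc_acceptor as qs N) (renumber qs N)"
  unfolding encodes_def
proof (intro conjI exI)
  show "buchi (renumber qs N)"
    by (rule renumber(1)[OF assms])
  show "distinct [0..<length qs]"
    by simp
  show "set [0..<length qs] = states (renumber qs N)"
    by (auto simp: renumber_def)
  show "enc_acceptor as qs N = enc_acceptor as [0..<length qs] (renumber qs N)"
    by (rule renumber(2)[OF assms, symmetric])
qed

text \<open>The tree determines the language, so runs need not be translated.\<close>

lemma language_renumber:
  fixes N :: "('q, 'a) acceptor" and as :: "'a list"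
  assumes "set as = UNIV" and N: "buchi N" "distinct qs" "set qs = states N"
  shows "language (renumber qs N) = language N"
proof -
  have r: "buchi (renumber qs N)" "distinct [0..<length qs]"
    "set [0..<length qs] = states (renumber qs N)"
    using renumber(1)[OF N] by (auto simp: renumber_def)
  note e = renumber(2)[OF N, of as]
  show ?thesis
    using language_subset_if_enc_acceptor_eq[OF assms(1) r N e]
      language_subset_if_enc_acceptor_eq[OF assms(1) N r e[symmetric]]
    by (rule subset_antisym)
qed

definition enc_lasso :: "'a list \<Rightarrow> 'q list \<Rightarrow> ('q, 'a) acceptor \<Rightarrow> 'a item list \<Rightarrow> 'a item list \<Rightarrow> tree" where
  "enc_lasso as qs M s l = enc_acceptor as (List.product [0..<length (s @ l)] qs) (lasso M s l)"

lemma oracle_lasso: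
  assumes "set as = UNIV" and M: "buchi M" "distinct qs" "set qs = states M" and "l \<noteq> []"
  shows "subset_oracle as L (enc_lasso as qs M s l) (\<not> refuted M L (s \<frown> l\<^sup>\<omega>))"
    and "deterministic M \<Longrightarrow>
      \<exists>N :: (nat, 'a) acceptor. encodes as (enc_lasso as qs M s l) N \<and> deterministic N"
proof -
  let ?rs = "List.product [0..<length (s @ l)] qs"
  have N: "buchi (lasso M s l)" "distinct ?rs" "set ?rs = states (lasso M s l)"
    using M buchi_lasso[OF M(1) assms(5)] by (auto simp: distinct_product lasso_def)
  have e: "encodes as (enc_lasso as qs M s l) (renumber ?rs (lasso M s l))"
    unfolding enc_lasso_def by (rule encodes_renumber[OF N])
  have "\<not> refuted M L (s \<frown> l\<^sup>\<omega>) \<longleftrightarrow> language (renumber ?rs (lasso M s l)) \<subseteq> L"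
    using language_renumber[OF assms(1) N] language_lasso[OF assms(5)] by metis
  then show "subset_oracle as L (enc_lasso as qs M s l) (\<not> refuted M L (s \<frown> l\<^sup>\<omega>))"
    unfolding subset_oracle_def using e by blast
  show "deterministic M \<Longrightarrow>
      \<exists>N :: (nat, 'a) acceptor. encodes as (enc_lasso as qs M s l) N \<and> deterministic N"
    using e renumber(3)[OF N] deterministic_lasso[OF M(1)] by blast
qed

lemma size_enc_list:
  "(\<And>t. t \<in> set ts \<Longrightarrow> size t \<le> c) \<Longrightarrow> size (enc_list ts) \<le> length ts * (c + 1)"
proof (induction ts)
  case (Cons t ts)
  then have "size t \<le> c" "size (enc_list ts) \<le> length ts * (c + 1)"
    by simp_all
  then show ?case
    by simp
qed simp

lemma size_enc_bool: "size (enc_bool b) \<le> 1"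
  by (cases b) auto

lemma size_enc_nat: "size (enc_nat n) = n"
  by (induction n) auto

lemma size_enc_list_map:
  "(\<And>x. size (f x) \<le> c) \<Longrightarrow> size (enc_list (map f xs)) \<le> length xs * (c + 1)"
  using size_enc_list[of "map f xs" c] by auto

lemma size_enc_acceptor:
  "size (enc_acceptor as qs N) \<le> length qs * (length as * (length qs * (1 + 1) + 1) + 4 + 1)"
  unfolding enc_acceptor_def
proof (rule size_enc_list_map)
  fix p
  have "size (enc_list (map (\<lambda>a. enc_list (map (\<lambda>q. enc_bool (q \<in> delta N p a)) qs)) as)) \<le>
      length as * (length qs * (1 + 1) + 1)"
    by (intro size_enc_list_map size_enc_bool)
  then show "size (Node (enc_bool (p = initial N)) (Node (enc_bool (p \<in> accepting N))
       (enc_list (map (\<lambda>a. enc_list (map (\<lambda>q. enc_bool (q \<in> delta N p a)) qs)) as)))) \<le>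
      length as * (length qs * (1 + 1) + 1) + 4"
    using size_enc_bool[of "p = initial N"] size_enc_bool[of "p \<in> accepting N"] by simp
qed

text \<open>With positions enumerated outermost, the rows form one block per position and every
  successor vector splits likewise. The program assembles the table in this form.\<close>

lemma enc_lasso_eq:
  fixes M :: "('q, 'a) acceptor"
  shows "enc_lasso as qs M s l = enc_list (concat (map (\<lambda>c. map (\<lambda>p.
     Node (enc_bool (c = 0 \<and> p = initial M)) (Node (enc_bool (p \<in> accepting M))
       (enc_list (map (\<lambda>a. enc_list (concat (map (\<lambda>c'.
          map (\<lambda>q. enc_bool (c' = lasso_next s l c \<and> q \<in> delta M p a \<and> admits M ((s @ l) ! c) a q)) qs)
          [0..<length (s @ l)]))) as)))) qs) [0..<length (s @ l)]))"
proof -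
  have "map f (List.product [0..<length (s @ l)] qs) =
      concat (map (\<lambda>c. map (\<lambda>p. f (c, p)) qs) [0..<length (s @ l)])" for f :: "nat \<times> 'q \<Rightarrow> tree"
    unfolding product_concat_map by (simp add: map_concat comp_def)
  then show ?thesis
    unfolding enc_lasso_def enc_acceptor_def
    by (auto simp: lasso_def intro!: arg_cong[of _ _ enc_list] arg_cong[of _ _ concat])
qed


section \<open>Cost-bounded evaluation\<close>

text \<open>Upper bounds and a property of all queries compose along the program, where exact times
  and query lists would have to be computed.\<close>

definition runs ::
  "program \<Rightarrow> (tree \<Rightarrow> bool \<Rightarrow> bool) \<Rightarrow> (tree \<Rightarrow> bool) \<Rightarrow> tree list \<Rightarrow> expr \<Rightarrow> tree \<Rightarrow> nat \<Rightarrow> bool" where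
  "runs P ask G env e v T \<longleftrightarrow> (\<exists>t qs. eval P ask env e v t qs \<and> t \<le> T \<and> (\<forall>y \<in> set qs. G y))"

definition run ::
  "program \<Rightarrow> (tree \<Rightarrow> bool \<Rightarrow> bool) \<Rightarrow> (tree \<Rightarrow> bool) \<Rightarrow> nat \<Rightarrow> tree \<Rightarrow> tree \<Rightarrow> nat \<Rightarrow> bool" where
  "run P ask G f x v T \<longleftrightarrow> f < length P \<and> runs P ask G [x] (P ! f) v T"

text \<open>Expressions without calls and queries have a value that the simplifier can compute.\<close>

fun simple :: "nat \<Rightarrow> expr \<Rightarrow> bool" where
  "simple n (Var i) \<longleftrightarrow> i < n"
| "simple n Empty \<longleftrightarrow> True"
| "simple n (Pair e1 e2) \<longleftrightarrow> simple n e1 \<and> simple n e2"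
| "simple n (Fst e) \<longleftrightarrow> simple n e"
| "simple n (Snd e) \<longleftrightarrow> simple n e"
| "simple n (If e e1 e2) \<longleftrightarrow> simple n e \<and> simple n e1 \<and> simple n e2"
| "simple n (Let e1 e2) \<longleftrightarrow> False"
| "simple n (Call f e) \<longleftrightarrow> False"
| "simple n (Query e) \<longleftrightarrow> False"

fun sval :: "tree list \<Rightarrow> expr \<Rightarrow> tree" where
  "sval env (Var i) = env ! i"
| "sval env (Pair e1 e2) = Node (sval env e1) (sval env e2)"
| "sval env (Fst e) = left (sval env e)"
| "sval env (Snd e) = right (sval env e)"
| "sval env (If e e1 e2) = (if sval env e \<noteq> Leaf then sval env e1 else sval env e2)"
| "sval env _ = Leaf"

fun cost :: "expr \<Rightarrow> nat" where
  "cost (Pair e1 e2) = cost e1 + cost e2 + 1"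
| "cost (Fst e) = cost e + 1"
| "cost (Snd e) = cost e + 1"
| "cost (If e e1 e2) = cost e + cost e1 + cost e2 + 1"
| "cost _ = 1"

text \<open>Trees that depend only on the alphabet are written into the program text; their cost is
  a constant of the analysis.\<close>

fun quote :: "tree \<Rightarrow> expr" where
  "quote Leaf = Empty"
| "quote (Node x y) = Pair (quote x) (quote y)"

lemma simple_quote [simp]: "simple n (quote t)"
  by (induction t) auto

lemma sval_quote [simp]: "sval env (quote t) = t"
  by (induction t) auto

lemma eval_simple:
  "simple (length env) e \<Longrightarrow> \<exists>t \<le> cost e. eval P ask env e (sval env e) t []"
proof (induction e)
  case (Var i)
  then show ?case using eval_Var by fastforce
next
  case Empty
  then show ?case using eval_Empty by fastforce
next
  case (Pair e1 e2)
  then obtain t1 t2 where "t1 \<le> cost e1" "eval P ask env e1 (sval env e1) t1 []"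
    "t2 \<le> cost e2" "eval P ask env e2 (sval env e2) t2 []"
    by auto
  then show ?case
    using eval_Pair[of P ask env e1 "sval env e1" t1 "[]" e2 "sval env e2" t2 "[]"]
    by (intro exI[of _ "t1 + t2 + 1"]) simp
next
  case (Fst e)
  then obtain t where "t \<le> cost e" "eval P ask env e (sval env e) t []"
    by auto
  then show ?case
    using eval_Fst[of P ask env e "sval env e" t "[]"] by (intro exI[of _ "t + 1"]) simp
next
  case (Snd e)
  then obtain t where "t \<le> cost e" "eval P ask env e (sval env e) t []"
    by auto
  then show ?case
    using eval_Snd[of P ask env e "sval env e" t "[]"] by (intro exI[of _ "t + 1"]) simp
next
  case (If e e1 e2)
  then obtain t t1 t2 where *: "t \<le> cost e" "eval P ask env e (sval env e) t []"
    "t1 \<le> cost e1" "eval P ask env e1 (sval env e1) t1 []"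
    "t2 \<le> cost e2" "eval P ask env e2 (sval env e2) t2 []"
    by auto
  show ?case
  proof (cases "sval env e = Leaf")
    case True
    then show ?thesis
      using * eval_If[of P ask env e "sval env e" t "[]" e1 e2 "sval env e2" t2 "[]"]
      by (intro exI[of _ "t + t2 + 1"]) simp
  next
    case False
    then show ?thesis
      using * eval_If[of P ask env e "sval env e" t "[]" e1 e2 "sval env e1" t1 "[]"]
      by (intro exI[of _ "t + t1 + 1"]) simp
  qed
qed auto

lemma runs_simple:
  assumes "simple (length env) e" and "sval env e = v"
  shows "runs P ask G env e v (cost e)"
proof -
  obtain t where "t \<le> cost e" "eval P ask env e v t []"
    using eval_simple[OF assms(1)] assms(2) by blast
  then show ?thesis
    unfolding runs_def by (intro exI[of _ t] exI[of _ "[]"]) simp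
qed

lemma runs_If_true:
  assumes "simple (length env) e" and "sval env e \<noteq> Leaf" and "runs P ask G env e1 v T"
  shows "runs P ask G env (If e e1 e2) v (cost e + T + 1)"
proof -
  obtain t where "t \<le> cost e" "eval P ask env e (sval env e) t []"
    using eval_simple[OF assms(1)] by blast
  moreover obtain t' qs where "eval P ask env e1 v t' qs" "t' \<le> T" "\<forall>y \<in> set qs. G y"
    using assms(3) unfolding runs_def by blast
  ultimately show ?thesis
    using assms(2) eval_If[of P ask env e "sval env e" t "[]" e1 e2 v t' qs]
    unfolding runs_def by (intro exI[of _ "t + t' + 1"] exI[of _ qs]) simp
qed

lemma runs_If_false:
  assumes "simple (length env) e" and "sval env e = Leaf" and "runs P ask G env e2 v T"
  shows "runs P ask G env (If e e1 e2) v (cost e + T + 1)"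
proof -
  obtain t where "t \<le> cost e" "eval P ask env e (sval env e) t []"
    using eval_simple[OF assms(1)] by blast
  moreover obtain t' qs where "eval P ask env e2 v t' qs" "t' \<le> T" "\<forall>y \<in> set qs. G y"
    using assms(3) unfolding runs_def by blast
  ultimately show ?thesis
    using assms(2) eval_If[of P ask env e "sval env e" t "[]" e1 e2 v t' qs]
    unfolding runs_def by (intro exI[of _ "t + t' + 1"] exI[of _ qs]) simp
qed

lemma runs_Call:
  assumes "simple (length env) e" and "sval env e = x" and "run P ask G f x v T"
  shows "runs P ask G env (Call f e) v (cost e + T + 1)"
proof -
  obtain t where "t \<le> cost e" "eval P ask env e x t []"
    using eval_simple[OF assms(1)] assms(2) by blast
  moreover obtain t' qs where "eval P ask [x] (P ! f) v t' qs" "t' \<le> T" "\<forall>y \<in> set qs. G y"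
    "f < length P"
    using assms(3) unfolding run_def runs_def by blast
  ultimately show ?thesis
    using eval_Call[of P ask env e x t "[]" f v t' qs]
    unfolding runs_def by (intro exI[of _ "t + t' + 1"] exI[of _ qs]) simp
qed

lemma runs_Let:
  assumes "runs P ask G env e1 v T1" and "runs P ask G (v # env) e2 w T2"
  shows "runs P ask G env (Let e1 e2) w (T1 + T2 + 1)"
proof -
  obtain t1 qs1 t2 qs2 where
    "eval P ask env e1 v t1 qs1" "t1 \<le> T1" "\<forall>y \<in> set qs1. G y"
    "eval P ask (v # env) e2 w t2 qs2" "t2 \<le> T2" "\<forall>y \<in> set qs2. G y"
    using assms unfolding runs_def by blast
  then show ?thesis
    using eval_Let[of P ask env e1 v t1 qs1 e2 w t2 qs2]
    unfolding runs_def by (intro exI[of _ "t1 + t2 + 1"] exI[of _ "qs1 @ qs2"]) auto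
qed

lemmas runs_Let_Call = runs_Let[OF runs_Call]

lemma runs_Query:
  assumes "simple (length env) e" and "sval env e = x" and "ask x b" and "G x"
  shows "runs P ask G env (Query e) (enc_bool b) (cost e + size x + 1)"
proof -
  obtain t where "t \<le> cost e" "eval P ask env e x t []"
    using eval_simple[OF assms(1)] assms(2) by blast
  then show ?thesis
    using assms(3,4) eval_Query[of P ask env e x t "[]" b]
    unfolding runs_def by (intro exI[of _ "t + size x + 1"] exI[of _ "[x]"]) simp
qed

text \<open>Value and time are first left as the rules produce them; \<open>v' = v\<close> and
  \<open>T' \<le> T\<close> compare them with the claim at the end.\<close>

lemma runI:
  assumes "f < length P" and "P ! f = e" and "runs P ask G [x] e v' T'" and "v' = v" and "T' \<le> T"
  shows "run P ask G f x v T"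
  using assms unfolding run_def runs_def by (meson le_trans)


section \<open>The program\<close>

abbreviation (input) "f_start \<equiv> 0 :: nat"
abbreviation (input) "f_query \<equiv> 1 :: nat"
abbreviation (input) "f_levels \<equiv> 2 :: nat"
abbreviation (input) "f_rows \<equiv> 3 :: nat"
abbreviation (input) "f_letters \<equiv> 4 :: nat"
abbreviation (input) "f_spread \<equiv> 5 :: nat"
abbreviation (input) "f_mask \<equiv> 6 :: nat"
abbreviation (input) "f_meet \<equiv> 7 :: nat"
abbreviation (input) "f_append \<equiv> 8 :: nat"
abbreviation (input) "f_accs \<equiv> 9 :: nat"
abbreviation (input) "f_mark \<equiv> 10 :: nat"
abbreviation (input) "f_stem \<equiv> 11 :: nat"
abbreviation (input) "f_rest \<equiv> 12 :: nat"
abbreviation (input) "f_extend \<equiv> 13 :: nat"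
abbreviation (input) "f_dist \<equiv> 14 :: nat"
abbreviation (input) "f_infix \<equiv> 15 :: nat"
abbreviation (input) "f_suffix \<equiv> 16 :: nat"
abbreviation (input) "f_refine \<equiv> 17 :: nat"
abbreviation (input) "f_pick \<equiv> 18 :: nat"
abbreviation (input) "f_output \<equiv> 19 :: nat"
abbreviation (input) "f_main \<equiv> 20 :: nat"

abbreviation (input) "v0 \<equiv> Var 0"
abbreviation (input) "v1 \<equiv> Var 1"
abbreviation (input) "v2 \<equiv> Var 2"
abbreviation (input) "v3 \<equiv> Var 3"

abbreviation (input) "Fst1 e \<equiv> Fst (Snd e)"
abbreviation (input) "Fst2 e \<equiv> Fst (Snd (Snd e))"
abbreviation (input) "Fst3 e \<equiv> Fst (Snd (Snd (Snd e)))"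
abbreviation (input) "Snd2 e \<equiv> Snd (Snd e)"
abbreviation (input) "Snd3 e \<equiv> Snd (Snd (Snd e))"
abbreviation (input) "Snd4 e \<equiv> Snd (Snd (Snd (Snd e)))"

text \<open>
  A letter is stored together with its output form. \<open>None\<close> stands for an arbitrary letter.
\<close>

definition enc_letter :: "'a list \<Rightarrow> 'a option \<Rightarrow> tree" where
  "enc_letter as x = Node (enc_list (map (\<lambda>a. enc_bool (x = None \<or> x = Some a)) as))
     (case x of None \<Rightarrow> Leaf | Some a \<Rightarrow> enc_nat (length (takeWhile (\<lambda>b. b \<noteq> a) as)))"

definition enc_item :: "'a list \<Rightarrow> 'a item \<Rightarrow> tree" where
  "enc_item as it = Node (enc_letter as (fst it)) (enc_bool (snd it))"

definition enc_items :: "'a list \<Rightarrow> 'a item list \<Rightarrow> tree" where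
  "enc_items as its = enc_list (map (enc_item as) its)"

definition any_const :: "'a list \<Rightarrow> expr" where
  "any_const as = quote (enc_item as any)"

definition goal_const :: "'a list \<Rightarrow> expr" where
  "goal_const as = quote (enc_item as (None, True))"

definition letters_const :: "'a list \<Rightarrow> expr" where
  "letters_const as = quote (enc_list (map (\<lambda>a. enc_letter as (Some a)) as))"

text \<open>
  In the arguments, \<open>x\<close> is the table of the given acceptor, and the parameters stem, loop and items are
  lists of encoded items. A level is a position in the list of all items; it is given by a
  one-hot bit vector.
\<close>

definition start_body :: "'a list \<Rightarrow> expr" where
  \<comment> \<open>argument: \<open>x\<close>\<close>
  "start_body as =
    Let (Call f_query (Pair v0 (Pair Empty (Pair (any_const as) Empty))))
      (If v0 Empty (Call f_main (Pair Empty (Pair Empty v1))))"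

definition query_body :: expr where
  \<comment> \<open>argument: \<open>(x, stem, loop)\<close>\<close>
  "query_body =
    Let (Call f_accs (Fst v0)) (Let (Call f_mark (Fst1 v1)) (Let (Call f_append (Snd v2))
      (Let (Call f_levels (Pair v0 (Pair (Pair Empty (Pair (Pair Empty Empty) Empty))
          (Pair (Pair Empty Empty) (Pair v1 (Pair v0 (Pair v2 (Fst v3))))))))
        (Query v0))))"

definition levels_body :: expr where
  \<comment> \<open>argument: \<open>(items, next level, first?, level after the last, all items, accepting, x)\<close>\<close>
  "levels_body =
    If (Fst v0)
      (Let (Call f_levels (Pair (Snd (Fst v0)) (Pair (Pair Empty (Fst1 v0)) (Pair Empty (Snd3 v0)))))
        (Let (Call f_rows (Pair (Snd3 (Snd3 v1)) (Pair (Fst2 v1) (Pair (Fst (Fst v1))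
            (Pair (If (Snd (Fst v1)) (Fst1 v1) (Fst3 v1)) (Pair (Fst (Snd4 v1)) (Fst (Snd (Snd4 v1)))))))))
          (Call f_append (Pair v0 v1))))
      Empty"

definition rows_body :: expr where
  \<comment> \<open>argument: \<open>(rows of x, first?, item, next level, all items, accepting)\<close>\<close>
  "rows_body =
    If (Fst v0)
      (Let (Call f_rows (Pair (Snd (Fst v0)) (Snd v0)))
        (Let (Call f_letters (Pair (Snd2 (Fst (Fst v1))) (Pair (Fst (Fst (Fst2 v1)))
            (Pair (Snd (Fst2 v1)) (Snd3 v1)))))
          (Pair (Pair (If (Fst1 v2) (Fst (Fst (Fst v2))) Empty) (Pair (Fst1 (Fst (Fst v2))) v0)) v1)))
      Empty"

definition letters_body :: expr where
  \<comment> \<open>argument: \<open>(successor vectors, letter mask, goal?, next level, all items, accepting)\<close>\<close>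
  "letters_body =
    If (Fst v0)
      (Let (Call f_letters (Pair (Snd (Fst v0)) (Pair (Snd (Fst1 v0)) (Snd2 v0))))
        (Let (Call f_meet (Pair (Fst (Fst v1)) (Snd (Snd4 v1))))
          (Let (Call f_mask (Pair (Fst (Fst1 v2)) (If (Fst2 v2) v0 (Fst (Fst v2)))))
            (Let (Call f_spread (Pair v0 (Pair (Fst3 v3) (Fst (Snd4 v3)))))
              (Pair v0 v3)))))
      Empty"

definition spread_body :: expr where
  \<comment> \<open>argument: \<open>(vector, level, all items)\<close>\<close>
  "spread_body =
    If (Snd2 v0)
      (Let (Call f_spread (Pair (Fst v0) (Pair (Snd (Fst1 v0)) (Snd3 v0))))
        (Let (Call f_mask (Pair (Fst (Fst1 v1)) (Fst v1)))
          (Call f_append (Pair v0 v1))))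
      Empty"

definition mask_body :: expr where
  \<comment> \<open>argument: \<open>(bit, vector)\<close>\<close>
  "mask_body =
    If (Snd v0)
      (Let (Call f_mask (Pair (Fst v0) (Snd2 v0)))
        (Pair (If (Fst v1) (Fst1 v1) Empty) v0))
      Empty"

definition meet_body :: expr where
  "meet_body =
    If (Fst v0)
      (Let (Call f_meet (Pair (Snd (Fst v0)) (Snd2 v0)))
        (Pair (If (Fst (Fst v1)) (Fst1 v1) Empty) v0))
      Empty"

definition append_body :: expr where
  "append_body =
    If (Fst v0)
      (Let (Call f_append (Pair (Snd (Fst v0)) (Snd v0)))
        (Pair (Fst (Fst v1)) v0))
      (Snd v0)"

definition accs_body :: expr where
  "accs_body =
    If v0 (Let (Call f_accs (Snd v0)) (Pair (Fst1 (Fst v1)) v0)) Empty"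

definition mark_body :: expr where
  "mark_body =
    If v0 (Let (Call f_mark (Snd v0)) (Pair Empty v0)) (Pair (Pair Empty Empty) Empty)"

definition stem_body :: "'a list \<Rightarrow> expr" where
  \<comment> \<open>argument: \<open>(remaining length, stem, loop, x)\<close>\<close>
  "stem_body as =
    Let (Call f_query (Pair (Snd3 v0) (Pair (Fst1 v0) (Fst2 v0))))
      (If v0
        (If (Fst v1) (Call f_stem (Pair (Snd (Fst v1)) (Pair (Pair (any_const as) (Fst1 v1)) (Snd2 v1)))) Empty)
        (Pair (Fst1 v1) Empty))"

definition rest_body :: "'a list \<Rightarrow> expr" where
  \<comment> \<open>argument: \<open>(remaining length, rest of the loop, initial part of the loop, bound, x)\<close>\<close>
  "rest_body as =
    Let (Call f_append (Pair (Fst2 v0) (Fst1 v0)))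
      (Let (Call f_stem (Pair (Fst3 v1) (Pair Empty (Pair v0 (Snd4 v1)))))
        (If v0 (Pair Empty Empty)
          (If (Fst v2) (Call f_rest (Pair (Snd (Fst v2)) (Pair (Pair (any_const as) (Fst1 v2)) (Snd2 v2)))) Empty)))"

definition extend_body :: expr where
  \<comment> \<open>argument: \<open>(letters, items up to the next goal, initial part of the loop, bound, x)\<close>\<close>
  "extend_body =
    If (Fst v0)
      (Let (Call f_append (Pair (Fst2 v0) (Pair (Pair (Fst (Fst v0)) (Snd (Fst (Fst1 v0)))) Empty)))
        (Let (Call f_append (Pair v0 (Snd (Fst1 v1))))
          (Let (Call f_rest (Pair (Fst3 v2) (Pair Empty (Pair v0 (Snd3 v2)))))
            (If v0 v2 (Call f_extend (Pair (Snd (Fst v3)) (Snd v3)))))))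
      Empty"

definition dist_body :: "'a list \<Rightarrow> expr" where
  \<comment> \<open>argument: \<open>(remaining distance, items up to the next goal, initial part of the loop, bound, x)\<close>\<close>
  "dist_body as =
    Let (Call f_extend (Pair (letters_const as) (Snd v0)))
      (If v0 v0
        (If (Fst v1) (Call f_dist (Pair (Snd (Fst v1)) (Pair (Pair (any_const as) (Fst1 v1)) (Snd2 v1)))) Empty))"

definition infix_body :: expr where
  \<comment> \<open>argument: \<open>(loop, items to be appended, bound, x)\<close>\<close>
  "infix_body =
    If (Fst1 v0)
      (Let (Call f_append (Pair (Fst v0) (Pair (Fst (Fst1 v0)) Empty)))
        (Let (Call f_stem (Pair (Fst2 v1) (Pair Empty (Pair v0 (Snd3 v1)))))
          (If v0 (Call f_refine (Pair Empty (Pair (Fst v0) (Pair v1 (Snd3 v2)))))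
            (Call f_infix (Pair v1 (Pair (Snd (Fst1 v2)) (Snd2 v2)))))))
      Empty"

definition suffix_body :: expr where
  \<comment> \<open>argument: \<open>(items, bound, x)\<close>\<close>
  "suffix_body =
    If (Fst v0)
      (Let (Call f_infix (Pair Empty v0))
        (If v0 v0 (Call f_suffix (Pair (Snd (Fst v1)) (Snd v1)))))
      Empty"

definition refine_body :: "'a list \<Rightarrow> expr" where
  \<comment> \<open>argument: \<open>(refined stem, rest of the stem, loop, x)\<close>\<close>
  "refine_body as =
    If (Fst1 v0)
      (Call f_pick (Pair (letters_const as) (Pair (Fst v0) (Pair (Snd (Fst1 v0)) (Snd2 v0)))))
      (Let (Call f_output (Fst v0)) (Let (Call f_output (Fst2 v1)) (Pair v1 v0)))"

definition pick_body :: expr where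
  \<comment> \<open>argument: \<open>(letters, refined stem, rest of the stem, loop, x)\<close>\<close>
  "pick_body =
    Let (Call f_append (Pair (Fst1 v0) (Pair (Pair (Fst (Fst v0)) Empty) Empty)))
      (Let (Call f_append (Pair v0 (Fst2 v1)))
        (Let (Call f_query (Pair (Snd4 v2) (Pair v0 (Fst3 v2))))
          (If v0 (Call f_pick (Pair (Snd (Fst v3)) (Snd v3)))
            (Call f_refine (Pair v2 (Snd2 v3))))))"

definition output_body :: expr where
  "output_body =
    If v0 (Let (Call f_output (Snd v0)) (Pair (Snd (Fst (Fst v1))) v0)) Empty"

definition main_body :: "'a list \<Rightarrow> expr" where
  \<comment> \<open>argument: \<open>(bound, initial part of the loop, x)\<close>\<close>
  "main_body as =
    Let (Call f_suffix (Pair (Fst1 v0) (Pair (Fst v0) (Snd2 v0))))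
      (If v0 v0
        (Let (Call f_dist (Pair (Fst v1) (Pair (Pair (goal_const as) Empty)
            (Pair (Fst1 v1) (Pair (Fst v1) (Snd2 v1))))))
          (Call f_main (Pair (Pair Empty (Fst v2)) (Pair v0 (Snd2 v2))))))"

definition search_program :: "'a list \<Rightarrow> program" where
  "search_program as = [start_body as, query_body, levels_body, rows_body, letters_body, spread_body, mask_body, meet_body, append_body, accs_body, mark_body, stem_body as, rest_body as, extend_body, dist_body as, infix_body, suffix_body, refine_body as, pick_body, output_body, main_body as]"

lemma length_search_program [simp]: "length (search_program as) = 21"
  by (simp add: search_program_def)

lemma search_program_nth:
  "search_program as ! f_start = start_body as"
  "search_program as ! f_query = query_body"
  "search_program as ! f_levels = levels_body"
  "search_program as ! f_rows = rows_body"
  "search_program as ! f_letters = letters_body"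
  "search_program as ! f_spread = spread_body"
  "search_program as ! f_mask = mask_body"
  "search_program as ! f_meet = meet_body"
  "search_program as ! f_append = append_body"
  "search_program as ! f_accs = accs_body"
  "search_program as ! f_mark = mark_body"
  "search_program as ! f_stem = stem_body as"
  "search_program as ! f_rest = rest_body as"
  "search_program as ! f_extend = extend_body"
  "search_program as ! f_dist = dist_body as"
  "search_program as ! f_infix = infix_body"
  "search_program as ! f_suffix = suffix_body"
  "search_program as ! f_refine = refine_body as"
  "search_program as ! f_pick = pick_body"
  "search_program as ! f_output = output_body"
  "search_program as ! f_main = main_body as"
  by (simp_all add: search_program_def)

lemmas run_start_body = runI[OF _ search_program_nth(1)[unfolded start_body_def]]
lemmas run_query_body = runI[OF _ search_program_nth(2)[unfolded query_body_def]]
lemmas run_levels_body = runI[OF _ search_program_nth(3)[unfolded levels_body_def]]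
lemmas run_rows_body = runI[OF _ search_program_nth(4)[unfolded rows_body_def]]
lemmas run_letters_body = runI[OF _ search_program_nth(5)[unfolded letters_body_def]]
lemmas run_spread_body = runI[OF _ search_program_nth(6)[unfolded spread_body_def]]
lemmas run_mask_body = runI[OF _ search_program_nth(7)[unfolded mask_body_def]]
lemmas run_meet_body = runI[OF _ search_program_nth(8)[unfolded meet_body_def]]
lemmas run_append_body = runI[OF _ search_program_nth(9)[unfolded append_body_def]]
lemmas run_accs_body = runI[OF _ search_program_nth(10)[unfolded accs_body_def]]
lemmas run_mark_body = runI[OF _ search_program_nth(11)[unfolded mark_body_def]]
lemmas run_stem_body = runI[OF _ search_program_nth(12)[unfolded stem_body_def]]
lemmas run_rest_body = runI[OF _ search_program_nth(13)[unfolded rest_body_def]]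
lemmas run_extend_body = runI[OF _ search_program_nth(14)[unfolded extend_body_def]]
lemmas run_dist_body = runI[OF _ search_program_nth(15)[unfolded dist_body_def]]
lemmas run_infix_body = runI[OF _ search_program_nth(16)[unfolded infix_body_def]]
lemmas run_suffix_body = runI[OF _ search_program_nth(17)[unfolded suffix_body_def]]
lemmas run_refine_body = runI[OF _ search_program_nth(18)[unfolded refine_body_def]]
lemmas run_pick_body = runI[OF _ search_program_nth(19)[unfolded pick_body_def]]
lemmas run_output_body = runI[OF _ search_program_nth(20)[unfolded output_body_def]]
lemmas run_main_body = runI[OF _ search_program_nth(21)[unfolded main_body_def]]

definition const_cost :: "'a list \<Rightarrow> nat" where
  "const_cost as = cost (any_const as) + cost (goal_const as) + cost (letters_const as)"

lemma const_simps [simp]: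
  "simple n (any_const as)" "sval env (any_const as) = enc_item as any"
  "simple n (goal_const as)" "sval env (goal_const as) = enc_item as (None, True)"
  "simple n (letters_const as)"
  "sval env (letters_const as) = enc_list (map (\<lambda>a. enc_letter as (Some a)) as)"
  by (simp_all add: any_const_def goal_const_def letters_const_def)

section \<open>Time bounds in terms of a common bound \<open>B\<close> on alphabet, states and item
  lists\<close>

definition lin :: "nat \<Rightarrow> nat" where "lin B = 60 * (B + 1)"
definition t_spread :: "nat \<Rightarrow> nat" where "t_spread B = (B + 1) * (2 * lin B + 100)"
definition t_letters :: "nat \<Rightarrow> nat" where "t_letters B = (B + 1) * (2 * lin B + t_spread B + 100)"
definition t_rows :: "nat \<Rightarrow> nat" where "t_rows B = (B + 1) * (t_letters B + 100)"
definition t_levels :: "nat \<Rightarrow> nat" where "t_levels B = (B + 1) * (t_rows B + lin B + 100)"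
text \<open>\<open>size_enc_acceptor\<close> with \<open>B\<close> letters and \<open>B * B\<close>
  states, which are pairs of a position and a state of \<open>M\<close>.\<close>

definition query_size :: "nat \<Rightarrow> nat" where
  "query_size B = B * B * (B * (B * B * (1 + 1) + 1) + 4 + 1)"
definition t_query :: "nat \<Rightarrow> nat" where
  "t_query B = t_levels B + 3 * lin B + query_size B + 300"

definition t_stem :: "nat \<Rightarrow> nat \<Rightarrow> nat" where "t_stem K B = (B + 1) * (t_query B + K + 100)"
definition t_rest :: "nat \<Rightarrow> nat \<Rightarrow> nat" where
  "t_rest K B = (B + 1) * (t_stem K B + lin B + K + 100)"
definition t_extend :: "nat \<Rightarrow> nat \<Rightarrow> nat" where
  "t_extend K B = (B + 1) * (t_rest K B + 2 * lin B + 100)"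
definition t_dist :: "nat \<Rightarrow> nat \<Rightarrow> nat" where "t_dist K B = (B + 1) * (t_extend K B + K + 100)"

definition t_pick :: "nat \<Rightarrow> nat" where "t_pick B = (B + 1) * (t_query B + 2 * lin B + 100)"
definition t_refine :: "nat \<Rightarrow> nat \<Rightarrow> nat" where
  "t_refine K B = (B + 1) * (t_pick B + K + 2 * lin B + 100)"
text \<open>Refinement is added and not multiplied: one search enters it at most once, by a call
  that ends the search.\<close>

definition t_infix :: "nat \<Rightarrow> nat \<Rightarrow> nat" where
  "t_infix K B = (B + 1) * (t_stem K B + lin B + 100) + t_refine K B"
definition t_suffix :: "nat \<Rightarrow> nat \<Rightarrow> nat" where "t_suffix K B = (B + 1) * (t_infix K B + 100)"
definition t_main :: "nat \<Rightarrow> nat \<Rightarrow> nat" where "t_main K B = t_suffix K B + t_dist K B + K + 100"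

locale search =
  fixes as :: "'a list" and M :: "('q, 'a) acceptor" and L :: "'a word set" and qs :: "'q list"
    and B :: nat
  assumes as: "distinct as" "set as = UNIV"
    and M: "buchi M" and qs: "distinct qs" "set qs = states M"
    and B: "length as \<le> B" "length qs \<le> B"
begin

abbreviation allowed :: "tree \<Rightarrow> bool" where
  "allowed y \<equiv> deterministic M \<longrightarrow> (\<exists>N :: (nat, 'a) acceptor. encodes as y N \<and> deterministic N)"

abbreviation R :: "nat \<Rightarrow> tree \<Rightarrow> tree \<Rightarrow> nat \<Rightarrow> bool" where
  "R \<equiv> run (search_program as) (subset_oracle as L) allowed"

abbreviation X :: tree where
  "X \<equiv> enc_acceptor as qs M"

abbreviation bits :: "('b \<Rightarrow> bool) \<Rightarrow> 'b list \<Rightarrow> tree" where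
  "bits f xs \<equiv> enc_list (map (\<lambda>x. enc_bool (f x)) xs)"

lemma enc_bool_Leaf [simp]: "enc_bool b = Leaf \<longleftrightarrow> \<not> b"
  by (cases b) auto

lemma enc_list_Leaf [simp]: "enc_list xs = Leaf \<longleftrightarrow> xs = []"
  by (cases xs) auto

lemma enc_items_Leaf [simp]: "enc_items as xs = Leaf \<longleftrightarrow> xs = []" "Leaf = enc_items as xs \<longleftrightarrow> xs = []"
  by (cases xs; simp add: enc_items_def)+

lemma enc_items_simps [simp]:
  "enc_items as [] = Leaf"
  "enc_items as (it # its) = Node (enc_item as it) (enc_items as its)"
  by (simp_all add: enc_items_def)

section \<open>Elementary routines on lists and bit vectors\<close>

lemma run_append:
  "R f_append (Node (enc_list xs) (enc_list ys)) (enc_list (xs @ ys)) (60 * (length xs + 1))"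
proof (induction xs)
  case Nil
  show ?case
    by (rule run_append_body, simp, rule runs_If_false[OF _ _ runs_simple]) simp_all
next
  case (Cons x xs)
  show ?case
    by (rule run_append_body, simp,
        rule runs_If_true[OF _ _ runs_Let_Call[OF _ _ Cons runs_simple]]) simp_all
qed

lemma run_mask:
  "R f_mask (Node b (bits f xs)) (bits (\<lambda>x. b \<noteq> Leaf \<and> f x) xs) (60 * (length xs + 1))"
proof (induction xs)
  case Nil
  show ?case
    by (rule run_mask_body, simp, rule runs_If_false[OF _ _ runs_simple]) simp_all
next
  case (Cons x xs)
  show ?case
    by (rule run_mask_body, simp,
        rule runs_If_true[OF _ _ runs_Let_Call[OF _ _ Cons runs_simple]]) simp_all
qed

lemma run_meet:
  "R f_meet (Node (bits f xs) (bits g xs)) (bits (\<lambda>x. f x \<and> g x) xs) (60 * (length xs + 1))"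
proof (induction xs)
  case Nil
  show ?case
    by (rule run_meet_body, simp, rule runs_If_false[OF _ _ runs_simple]) simp_all
next
  case (Cons x xs)
  show ?case
    by (rule run_meet_body, simp,
        rule runs_If_true[OF _ _ runs_Let_Call[OF _ _ Cons runs_simple]]) simp_all
qed

lemma run_accs:
  "R f_accs (enc_list (map (\<lambda>p. Node (i p) (Node (enc_bool (f p)) (r p))) xs)) (bits f xs)
    (60 * (length xs + 1))"
proof (induction xs)
  case Nil
  show ?case
    by (rule run_accs_body, simp, rule runs_If_false[OF _ _ runs_simple]) simp_all
next
  case (Cons x xs)
  show ?case
    by (rule run_accs_body, simp,
        rule runs_If_true[OF _ _ runs_Let_Call[OF _ _ Cons runs_simple]]) simp_all
qed

text \<open>The position \<open>j\<close> in unary, as a bit vector that may be continued by zeros.\<close>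

definition mark :: "nat \<Rightarrow> tree" where
  "mark j = enc_list (replicate j Leaf @ [Node Leaf Leaf])"

lemma run_mark: "R f_mark (enc_list xs) (mark (length xs)) (60 * (length xs + 1))"
proof (induction xs)
  case Nil
  show ?case
    by (rule run_mark_body, simp, rule runs_If_false[OF _ _ runs_simple]) (simp_all add: mark_def)
next
  case (Cons x xs)
  show ?case
    by (rule run_mark_body, simp,
        rule runs_If_true[OF _ _ runs_Let_Call[OF _ _ Cons runs_simple]]) (simp_all add: mark_def)
qed

lemma right_funpow_Leaf: "(right ^^ c) Leaf = Leaf"
  by (induction c) auto

lemma left_mark: "left ((right ^^ c) (mark j)) \<noteq> Leaf \<longleftrightarrow> c = j"
proof (induction j arbitrary: c)
  case 0
  then show ?case
    by (cases c) (simp_all add: mark_def funpow_Suc_right right_funpow_Leaf del: funpow.simps(2))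
next
  case (Suc j)
  then show ?case
    by (cases c) (simp_all add: mark_def funpow_Suc_right del: funpow.simps(2))
qed

section \<open>Building the transition table of a lasso and querying it\<close>

abbreviation spread :: "nat \<Rightarrow> (nat \<Rightarrow> bool) \<Rightarrow> ('q \<Rightarrow> bool) \<Rightarrow> tree" where
  "spread k g f \<equiv> enc_list (concat (map (\<lambda>c. map (\<lambda>q. enc_bool (g c \<and> f q)) qs) [0..<k]))"

text \<open>Stated for any tree \<open>t\<close>, because the recursion passes to
  \<open>right t\<close>, which is no longer a mark once the one has been consumed. Beyond its end
  \<open>t\<close> reads as zeros.\<close>

lemma run_spread_tree:
  "R f_spread (Node (bits f qs) (Node t (enc_list gs)))
    (spread (length gs) (\<lambda>c. left ((right ^^ c) t) \<noteq> Leaf) f)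
    ((length gs + 1) * (2 * lin B + 100))"
proof (induction gs arbitrary: t)
  case Nil
  show ?case
    by (rule run_spread_body, simp, rule runs_If_false[OF _ _ runs_simple]) simp_all
next
  case (Cons g gs)
  have upt: "[0..<Suc (length gs)] = 0 # map Suc [0..<length gs]"
    by (simp add: upt_conv_Cons map_Suc_upt del: upt_Suc)
  have lin: "60 * (length qs + 1) \<le> lin B"
    using B by (simp add: lin_def)
  show ?case
    by (rule run_spread_body, simp, rule runs_If_true[OF _ _ runs_Let_Call[OF _ _
          Cons[of "right t"] runs_Let_Call[OF _ _ run_mask[of "left t" f qs]
          runs_Call[OF _ _ run_append[of "map (\<lambda>q. enc_bool (left t \<noteq> Leaf \<and> f q)) qs"
            "concat (map (\<lambda>c. map (\<lambda>q. enc_bool (left ((right ^^ c) (right t)) \<noteq> Leaf \<and> f q)) qs)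
              [0..<length gs])"]]]]])
      (use lin in \<open>simp_all add: upt funpow_swap1 comp_def del: upt_Suc\<close>)
qed

lemma run_spread:
  assumes "length gs \<le> B"
  shows "R f_spread (Node (bits f qs) (Node (mark j) (enc_list gs)))
    (spread (length gs) (\<lambda>c. c = j) f) (t_spread B)"
proof -
  have "(length gs + 1) * (2 * lin B + 100) \<le> t_spread B"
    unfolding t_spread_def using assms by (intro mult_le_mono) auto
  then show ?thesis
    using run_spread_tree[of f "mark j" gs] unfolding left_mark run_def runs_def
    by (meson le_trans)
qed

lemma run_letters:
  assumes "length gs \<le> B"
  shows "R f_letters (Node (enc_list (map (\<lambda>a. bits (\<lambda>q. d a q) qs) ls)) (Node (bits h ls)
      (Node (enc_bool b) (Node (mark j) (Node (enc_list gs) (bits f qs))))))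
    (enc_list (map (\<lambda>a. spread (length gs) (\<lambda>c. c = j) (\<lambda>q. h a \<and> d a q \<and> (b \<longrightarrow> f q))) ls))
    ((length ls + 1) * (2 * lin B + t_spread B + 100))"
proof (induction ls)
  case Nil
  show ?case
    by (rule run_letters_body, simp, rule runs_If_false[OF _ _ runs_simple]) simp_all
next
  case (Cons a ls)
  have lin: "60 * (length qs + 1) \<le> lin B"
    using B by (simp add: lin_def)
  let ?f = "\<lambda>q. if b then d a q \<and> f q else d a q"
  have eq: "(enc_bool (h a) \<noteq> Leaf \<and> ?f q) = (h a \<and> d a q \<and> (b \<longrightarrow> f q))" for q
    by auto
  show ?case
    by (rule run_letters_body, simp, rule runs_If_true[OF _ _ runs_Let_Call[OF _ _ Cons
          runs_Let_Call[OF _ _ run_meet[of "d a" qs f]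
          runs_Let_Call[OF _ _ run_mask[of "enc_bool (h a)" ?f qs, unfolded eq]
          runs_Let_Call[OF _ _ run_spread[OF assms] runs_simple]]]]])
      (use lin in \<open>simp_all\<close>)
qed

definition level_rows :: "nat \<Rightarrow> nat \<Rightarrow> bool \<Rightarrow> 'a item \<Rightarrow> 'q list \<Rightarrow> tree list" where
  "level_rows k j b it ps = map (\<lambda>p. Node (enc_bool (b \<and> p = initial M))
     (Node (enc_bool (p \<in> accepting M)) (enc_list (map (\<lambda>a.
       spread k (\<lambda>c. c = j) (\<lambda>q. q \<in> delta M p a \<and> admits M it a q)) as)))) ps"

abbreviation table :: "'q list \<Rightarrow> tree" where
  "table ps \<equiv> enc_list (map (\<lambda>p. Node (enc_bool (p = initial M)) (Node (enc_bool (p \<in> accepting M))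
    (enc_list (map (\<lambda>a. bits (\<lambda>q. q \<in> delta M p a) qs) as)))) ps)"

lemma run_rows:
  assumes "length gs \<le> B"
  shows "R f_rows (Node (table ps) (Node (enc_bool b) (Node (enc_item as it)
      (Node (mark j) (Node (enc_list gs) (bits (\<lambda>q. q \<in> accepting M) qs))))))
    (enc_list (level_rows (length gs) j b it ps)) ((length ps + 1) * (t_letters B + 100))"
proof (induction ps)
  case Nil
  show ?case
    by (rule run_rows_body, simp, rule runs_If_false[OF _ _ runs_simple])
      (simp_all add: level_rows_def)
next
  case (Cons p ps)
  have "(length as + 1) * (2 * lin B + t_spread B + 100) \<le> t_letters B"
    unfolding t_letters_def using B by (intro mult_le_mono) auto
  moreover have "((fst it = None \<or> fst it = Some a) \<and> q \<in> delta M p a \<and>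
      (snd it \<longrightarrow> q \<in> accepting M)) = (q \<in> delta M p a \<and> admits M it a q)" for q a
    unfolding admits_def by blast
  ultimately show ?case
    by - (rule run_rows_body, simp, rule runs_If_true[OF _ _ runs_Let_Call[OF _ _ Cons
          runs_Let_Call[OF _ _ run_letters[OF assms, of "\<lambda>a q. q \<in> delta M p a" as
            "\<lambda>a. fst it = None \<or> fst it = Some a" "snd it" j "\<lambda>q. q \<in> accepting M"] runs_simple]]],
      simp_all add: enc_item_def enc_letter_def level_rows_def)
qed

text \<open>The one-hot vector of the next position grows along with the recursion, so positions are
  never computed; after the last item the stored vector of \<open>length s\<close> is used instead,
  which closes the loop.\<close>

lemma run_levels:
  assumes its: "its = s @ l" and "length its \<le> B" and "c \<le> length its"
  shows "R f_levels (Node (enc_items as (drop c its)) (Node (mark (Suc c)) (Node (enc_bool (c = 0))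
      (Node (mark (length s)) (Node (enc_items as its)
      (Node (bits (\<lambda>q. q \<in> accepting M) qs) X))))))
    (enc_list (concat (map (\<lambda>c. level_rows (length its) (lasso_next s l c) (c = 0) (its ! c) qs)
      [c..<length its])))
    ((length its - c + 1) * (t_rows B + lin B + 100))"
  using assms(3)
proof (induction "length its - c" arbitrary: c)
  case 0
  then show ?case
    by - (rule run_levels_body, simp, rule runs_If_false[OF _ _ runs_simple], simp_all)
next
  case (Suc n)
  let ?rows = "\<lambda>c. level_rows (length its) (lasso_next s l c) (c = 0) (its ! c) qs"
  have c: "c < length its"
    using Suc.hyps(2) by linarith
  then have drop: "drop c its = its ! c # drop (Suc c) its"
    by (simp only: Cons_nth_drop_Suc)
  have upt: "[c..<length its] = c # [Suc c..<length its]"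
    using c by (rule upt_conv_Cons)
  have IH: "R f_levels (Node (enc_items as (drop (Suc c) its)) (Node (mark (Suc (Suc c)))
      (Node (enc_bool False) (Node (mark (length s)) (Node (enc_items as its)
      (Node (bits (\<lambda>q. q \<in> accepting M) qs) X))))))
    (enc_list (concat (map ?rows [Suc c..<length its])))
    ((n + 1) * (t_rows B + lin B + 100))"
  proof -
    have n: "n = length its - Suc c"
      using Suc.hyps(2) by linarith
    show ?thesis
      using Suc.hyps(1)[OF n] c unfolding n[symmetric] by simp
  qed
  have gs: "length (map (enc_item as) its) \<le> B"
    using assms(2) by simp
  have lin: "60 * (length qs + 1) \<le> lin B"
    using B by (simp add: lin_def)
  have rows: "(length qs + 1) * (t_letters B + 100) \<le> t_rows B"
    unfolding t_rows_def using B by (intro mult_le_mono) auto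
  have mark: "mark (Suc (Suc c)) = Node Leaf (mark (Suc c))"
    by (simp add: mark_def)
  have next_mark: "(\<not> length its \<le> Suc c \<longrightarrow> mark (Suc c) = mark (lasso_next s l c)) \<and>
      (length its \<le> Suc c \<longrightarrow> mark (length s) = mark (lasso_next s l c))"
    using c unfolding lasso_next_def its by auto
  have len: "length (?rows c) = length qs"
    by (simp add: level_rows_def)
  show ?case
    apply (rule run_levels_body, simp, rule runs_If_true[OF _ _ runs_Let_Call[OF _ _ IH
          runs_Let_Call[OF _ _ run_rows[OF gs, of qs "c = 0" "its ! c" "lasso_next s l c"]
          runs_Call[OF _ _ run_append[of "?rows c" "concat (map ?rows [Suc c..<length its])"]]]]])
    unfolding drop upt len Suc.hyps(2)[symmetric]
    by (use lin rows next_mark in \<open>simp_all add: mark enc_items_def enc_acceptor_def\<close>)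
qed

lemma size_enc_lasso:
  assumes "length (s @ l) \<le> B"
  shows "size (enc_lasso as qs M s l) \<le> query_size B"
proof -
  let ?rs = "List.product [0..<length (s @ l)] qs"
  have "length ?rs \<le> B * B"
    using assms B(2) mult_le_mono[of "length (s @ l)" B "length qs" B] by simp
  then have "length ?rs * (length as * (length ?rs * (1 + 1) + 1) + 4 + 1) \<le>
      B * B * (B * (B * B * (1 + 1) + 1) + 4 + 1)"
    using B(1) by (intro mult_le_mono add_le_mono order_refl)
  then show ?thesis
    using size_enc_acceptor le_trans unfolding enc_lasso_def query_size_def by blast
qed

lemma run_query:
  assumes "length (s @ l) \<le> B" and "l \<noteq> []"
  shows "R f_query (Node X (Node (enc_items as s) (enc_items as l)))
    (enc_bool (\<not> refuted M L (s \<frown> l\<^sup>\<omega>))) (t_query B)"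
proof -
  have "length s \<le> B"
    using assms(1) by simp
  then have "60 * (length s + 1) \<le> lin B" "60 * (length qs + 1) \<le> lin B"
    using B by (simp_all add: lin_def)
  moreover have "(length (s @ l) - 0 + 1) * (t_rows B + lin B + 100) \<le> t_levels B"
    unfolding t_levels_def using assms(1) by (intro mult_le_mono) auto
  moreover note size_enc_lasso[OF assms(1)]
  \<comment> \<open>The assembled rows are the encoding of the lasso, so \<open>oracle_lasso\<close>
    supplies the answer and the determinism of the query.\<close>
  moreover have "enc_list (concat (map (\<lambda>c. level_rows (length (s @ l)) (lasso_next s l c) (c = 0)
      ((s @ l) ! c) qs) [0..<length (s @ l)])) = enc_lasso as qs M s l"
    unfolding enc_lasso_eq level_rows_def by (simp add: conj_assoc)
  ultimately show ?thesis
    by - (rule run_query_body, simp, rule runs_Let_Call[OF _ _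
      run_accs[of "\<lambda>p. enc_bool (p = initial M)" "\<lambda>p. p \<in> accepting M"
        "\<lambda>p. enc_list (map (\<lambda>a. bits (\<lambda>q. q \<in> delta M p a) qs) as)" qs]
      runs_Let_Call[OF _ _ run_mark[of "map (enc_item as) s"]
      runs_Let_Call[OF _ _ run_append[of "map (enc_item as) s" "map (enc_item as) l"]
      runs_Let_Call[OF _ _ run_levels[OF refl assms(1), of 0]
        runs_Query[where ask = "subset_oracle as L", OF _ _ oracle_lasso(1)[OF as(2) M qs assms(2)]]]]]],
      simp_all add: enc_items_def enc_acceptor_def mark_def t_query_def
        oracle_lasso(2)[OF as(2) M qs assms(2)], linarith)
qed

section \<open>Testing by queries whether a list of items can be continued\<close>

definition refutes :: "nat \<Rightarrow> 'a item list \<Rightarrow> bool" where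
  "refutes i l \<longleftrightarrow> refuted M L (replicate i any \<frown> l\<^sup>\<omega>)"

abbreviation K :: nat where
  "K \<equiv> const_cost as"

lemma cost_const: "cost (any_const as) \<le> K" "cost (goal_const as) \<le> K" "cost (letters_const as) \<le> K"
  "cost (letters_const as) + cost (any_const as) \<le> K" "cost (goal_const as) + cost (any_const as) \<le> K"
  by (simp_all add: const_cost_def)

text \<open>Success is wrapped as \<open>Node stem Leaf\<close>, since the empty stem is encoded by
  \<open>Leaf\<close> and would otherwise look like failure.\<close>

lemma run_stem_from:
  assumes "l \<noteq> []" and "j + k + length l \<le> B"
  shows "\<exists>r. R f_stem (Node (enc_nat k) (Node (enc_items as (replicate j any)) (Node (enc_items as l) X))) r
      ((k + 1) * (t_query B + K + 100)) \<and>
    (r = Leaf \<and> (\<forall>i. j \<le> i \<and> i \<le> j + k \<longrightarrow> \<not> refutes i l) \<or>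
     (\<exists>i \<le> j + k. refutes i l \<and> r = Node (enc_items as (replicate i any)) Leaf))"
  using assms(2)
proof (induction k arbitrary: j)
  case 0
  have q: "length (replicate j any @ l) \<le> B"
    using 0 by simp
  show ?case
  proof (cases "refutes j l")
    case True
    then show ?thesis
      by (intro exI[of _ "Node (enc_items as (replicate j any)) Leaf"] conjI)
        (rule run_stem_body, simp, rule runs_Let_Call[OF _ _ run_query[OF q assms(1), folded refutes_def]
          runs_If_false[OF _ _ runs_simple]], auto)
  next
    case False
    then show ?thesis
      by (intro exI[of _ Leaf] conjI)
        (rule run_stem_body, simp, rule runs_Let_Call[OF _ _ run_query[OF q assms(1), folded refutes_def]
          runs_If_true[OF _ _ runs_If_false[OF _ _ runs_simple]]], auto)
  qed
next
  case (Suc k)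
  have q: "length (replicate j any @ l) \<le> B"
    using Suc.prems by simp
  show ?case
  proof (cases "refutes j l")
    case True
    then show ?thesis
      by (intro exI[of _ "Node (enc_items as (replicate j any)) Leaf"] conjI)
        (rule run_stem_body, simp, rule runs_Let_Call[OF _ _ run_query[OF q assms(1), folded refutes_def]
          runs_If_false[OF _ _ runs_simple]], auto intro!: exI[of _ j])
  next
    case False
    obtain r where r: "R f_stem (Node (enc_nat k) (Node (enc_items as (replicate (Suc j) any))
        (Node (enc_items as l) X))) r ((k + 1) * (t_query B + K + 100))"
      and spec: "r = Leaf \<and> (\<forall>i. Suc j \<le> i \<and> i \<le> Suc j + k \<longrightarrow> \<not> refutes i l) \<or>
        (\<exists>i \<le> Suc j + k. refutes i l \<and> r = Node (enc_items as (replicate i any)) Leaf)"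
      using Suc.IH[of "Suc j"] Suc.prems by auto
    have "R f_stem (Node (enc_nat (Suc k)) (Node (enc_items as (replicate j any))
        (Node (enc_items as l) X))) r ((Suc k + 1) * (t_query B + K + 100))"
      by (rule run_stem_body, simp, rule runs_Let_Call[OF _ _ run_query[OF q assms(1), folded refutes_def]
          runs_If_true[OF _ _ runs_If_true[OF _ _ runs_Call[OF _ _ r]]]])
        (use False cost_const in simp_all)
    moreover have "r = Leaf \<and> (\<forall>i. j \<le> i \<and> i \<le> j + Suc k \<longrightarrow> \<not> refutes i l) \<or>
        (\<exists>i \<le> j + Suc k. refutes i l \<and> r = Node (enc_items as (replicate i any)) Leaf)"
      using spec False by (metis add_Suc add_Suc_right le_antisym not_less_eq_eq)
    ultimately show ?thesis
      by blast
  qed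
qed

lemma run_stem:
  assumes "l \<noteq> []" and "n + length l \<le> B"
  shows "\<exists>r. R f_stem (Node (enc_nat n) (Node Leaf (Node (enc_items as l) X))) r (t_stem K B) \<and>
    (r = Leaf \<and> (\<forall>i \<le> n. \<not> refutes i l) \<or>
     (\<exists>i \<le> n. refutes i l \<and> r = Node (enc_items as (replicate i any)) Leaf))"
proof -
  have "(n + 1) * (t_query B + K + 100) \<le> t_stem K B"
    unfolding t_stem_def using assms(2) by (intro mult_le_mono) auto
  then have "R f x r ((n + 1) * (t_query B + K + 100)) \<Longrightarrow> R f x r (t_stem K B)" for f x r
    unfolding run_def runs_def by (meson le_trans)
  then show ?thesis
    using run_stem_from[of l 0 n] assms by auto
qed

lemma run_rest_from:
  assumes "p \<noteq> []" and "n + length p + c + k \<le> B"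
  shows "R f_rest (Node (enc_nat k) (Node (enc_items as (replicate c any))
      (Node (enc_items as p) (Node (enc_nat n) X))))
    (enc_bool (\<exists>j. c \<le> j \<and> j \<le> c + k \<and> (\<exists>i \<le> n. refutes i (p @ replicate j any))))
    ((k + 1) * (t_stem K B + lin B + K + 100))"
  using assms(2)
proof (induction k arbitrary: c)
  case 0
  have lin: "60 * (length p + 1) \<le> lin B"
    using 0 by (simp add: lin_def)
  obtain r where r: "R f_stem (Node (enc_nat n) (Node Leaf
      (Node (enc_items as (p @ replicate c any)) X))) r (t_stem K B)"
    and spec: "r = Leaf \<longleftrightarrow> \<not> (\<exists>i \<le> n. refutes i (p @ replicate c any))"
    using run_stem[of "p @ replicate c any" n] assms(1) 0 by auto
  have ex: "(\<exists>j. c \<le> j \<and> j \<le> c + 0 \<and> (\<exists>i \<le> n. refutes i (p @ replicate j any))) \<longleftrightarrow> r \<noteq> Leaf"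
    unfolding spec by (metis add_0_right le_antisym order_refl)
  note first = run_append[of "map (enc_item as) p" "map (enc_item as) (replicate c any)"]
  show ?case
  proof (cases "r = Leaf")
    case True
    then show ?thesis unfolding ex
      by - (rule run_rest_body, simp, rule runs_Let_Call[OF _ _ first runs_Let_Call[OF _ _ r
        runs_If_false[OF _ _ runs_If_false[OF _ _ runs_simple]]]],
        use lin in \<open>simp_all add: enc_items_def\<close>)
  next
    case False
    then show ?thesis unfolding ex
      by - (rule run_rest_body, simp, rule runs_Let_Call[OF _ _ first runs_Let_Call[OF _ _ r
        runs_If_true[OF _ _ runs_simple]]],
        use lin in \<open>simp_all add: enc_items_def\<close>)
  qed
next
  case (Suc k)
  have lin: "60 * (length p + 1) \<le> lin B"
    using Suc.prems by (simp add: lin_def)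
  obtain r where r: "R f_stem (Node (enc_nat n) (Node Leaf
      (Node (enc_items as (p @ replicate c any)) X))) r (t_stem K B)"
    and spec: "r = Leaf \<longleftrightarrow> \<not> (\<exists>i \<le> n. refutes i (p @ replicate c any))"
    using run_stem[of "p @ replicate c any" n] assms(1) Suc.prems by auto
  note first = run_append[of "map (enc_item as) p" "map (enc_item as) (replicate c any)"]
  have split: "(\<exists>j. c \<le> j \<and> j \<le> c + Suc k \<and> Q j) \<longleftrightarrow>
      Q c \<or> (\<exists>j. Suc c \<le> j \<and> j \<le> Suc c + k \<and> Q j)" for Q
    by (metis add_Suc add_Suc_right le_add1 le_antisym not_less_eq_eq order_refl le_SucI)
  show ?case
  proof (cases "r = Leaf")
    case True
    have IH: "R f_rest (Node (enc_nat k) (Node (enc_items as (replicate (Suc c) any))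
      (Node (enc_items as p) (Node (enc_nat n) X))))
      (enc_bool (\<exists>j. Suc c \<le> j \<and> j \<le> Suc c + k \<and> (\<exists>i \<le> n. refutes i (p @ replicate j any))))
      ((k + 1) * (t_stem K B + lin B + K + 100))"
      using Suc.IH[of "Suc c"] Suc.prems by simp
    have "(\<exists>j. c \<le> j \<and> j \<le> c + Suc k \<and> (\<exists>i \<le> n. refutes i (p @ replicate j any))) \<longleftrightarrow>
        (\<exists>j. Suc c \<le> j \<and> j \<le> Suc c + k \<and> (\<exists>i \<le> n. refutes i (p @ replicate j any)))"
      using True spec unfolding split by blast
    then show ?thesis
      by (simp only:) (rule run_rest_body, simp, rule runs_Let_Call[OF _ _ first runs_Let_Call[OF _ _ r
        runs_If_false[OF _ _ runs_If_true[OF _ _ runs_Call[OF _ _ IH]]]]],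
        use True lin cost_const in \<open>simp_all add: enc_items_def\<close>)
  next
    case False
    then have "\<exists>j. c \<le> j \<and> j \<le> c + Suc k \<and> (\<exists>i \<le> n. refutes i (p @ replicate j any))"
      using spec unfolding split by simp
    then show ?thesis
      by (simp only:) (rule run_rest_body, simp, rule runs_Let_Call[OF _ _ first runs_Let_Call[OF _ _ r
        runs_If_true[OF _ _ runs_simple]]],
        use False lin in \<open>simp_all add: enc_items_def\<close>)
  qed
qed

lemma run_mono: "R f x v T \<Longrightarrow> T \<le> T' \<Longrightarrow> R f x v T'"
  unfolding run_def runs_def by (meson le_trans)

text \<open>The finite test that replaces \<open>good\<close>, with \<open>n\<close> bounding both
  the stem and the free part.\<close>

definition extends :: "nat \<Rightarrow> 'a item list \<Rightarrow> bool" where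
  "extends n p \<longleftrightarrow> (\<exists>j \<le> n. \<exists>i \<le> n. refutes i (p @ replicate j any))"

lemma run_rest:
  assumes "p \<noteq> []" and "n + length p + n \<le> B"
  shows "R f_rest (Node (enc_nat n) (Node Leaf (Node (enc_items as p) (Node (enc_nat n) X))))
    (enc_bool (extends n p)) (t_rest K B)"
proof -
  have "(n + 1) * (t_stem K B + lin B + K + 100) \<le> t_rest K B"
    unfolding t_rest_def using assms(2) by (intro mult_le_mono) auto
  then show ?thesis
    using run_mono[OF run_rest_from[of p n 0 n]] assms by (simp add: extends_def)
qed

text \<open>Only the first item of the goal is fixed and kept. The remaining ones,
  \<open>bs\<close>, take part in the test and are chosen anew in the next step.\<close>

lemma run_extend_list:
  assumes "n + (length y + 1 + length bs) + n \<le> B"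
  shows "\<exists>r. R f_extend (Node (enc_list (map (\<lambda>a. enc_letter as (Some a)) ls))
      (Node (enc_items as ((None, b) # bs)) (Node (enc_items as y) (Node (enc_nat n) X)))) r
      ((length ls + 1) * (t_rest K B + 2 * lin B + 100)) \<and>
    (r = Leaf \<and> (\<forall>a \<in> set ls. \<not> extends n (y @ (Some a, b) # bs)) \<or>
     (\<exists>a. extends n (y @ (Some a, b) # bs) \<and> r = enc_items as (y @ [(Some a, b)])))"
proof (induction ls)
  case Nil
  show ?case
    by (intro exI[of _ Leaf] conjI)
      (rule run_extend_body, simp, rule runs_If_false[OF _ _ runs_simple], simp_all)
next
  case (Cons a ls)
  let ?y = "y @ [(Some a, b)]"
  have lin: "60 * (length y + 1) \<le> lin B" "60 * (length ?y + 1) \<le> lin B"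
    using assms by (simp_all add: lin_def)
  note y = run_append[of "map (enc_item as) y" "[enc_item as (Some a, b)]"]
  note y' = run_append[of "map (enc_item as) ?y" "map (enc_item as) bs"]
  have rest: "R f_rest (Node (enc_nat n) (Node Leaf (Node (enc_items as (?y @ bs)) (Node (enc_nat n) X))))
    (enc_bool (extends n (y @ (Some a, b) # bs))) (t_rest K B)"
    using run_rest[of "?y @ bs" n] assms by simp
  show ?case
  proof (cases "extends n (y @ (Some a, b) # bs)")
    case True
    have "R f_extend (Node (enc_list (map (\<lambda>a. enc_letter as (Some a)) (a # ls)))
      (Node (enc_items as ((None, b) # bs)) (Node (enc_items as y) (Node (enc_nat n) X)))) (enc_items as ?y)
      ((length (a # ls) + 1) * (t_rest K B + 2 * lin B + 100))"
      by (rule run_extend_body, simp, rule runs_If_true[OF _ _ runs_Let_Call[OF _ _ y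
            runs_Let_Call[OF _ _ y' runs_Let_Call[OF _ _ rest[unfolded eqTrueI[OF True]]
            runs_If_true[OF _ _ runs_simple]]]]])
        (use lin in \<open>simp_all add: enc_items_def enc_item_def exactly_def\<close>)
    then show ?thesis
      using True by blast
  next
    case False
    obtain r where r: "R f_extend (Node (enc_list (map (\<lambda>a. enc_letter as (Some a)) ls))
        (Node (enc_items as ((None, b) # bs)) (Node (enc_items as y) (Node (enc_nat n) X)))) r
        ((length ls + 1) * (t_rest K B + 2 * lin B + 100))"
      and spec: "r = Leaf \<and> (\<forall>a \<in> set ls. \<not> extends n (y @ (Some a, b) # bs)) \<or>
        (\<exists>a. extends n (y @ (Some a, b) # bs) \<and> r = enc_items as (y @ [(Some a, b)]))"
      using Cons by blast
    have "R f_extend (Node (enc_list (map (\<lambda>a. enc_letter as (Some a)) (a # ls)))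
      (Node (enc_items as ((None, b) # bs)) (Node (enc_items as y) (Node (enc_nat n) X)))) r
      ((length (a # ls) + 1) * (t_rest K B + 2 * lin B + 100))"
      by (rule run_extend_body, simp, rule runs_If_true[OF _ _ runs_Let_Call[OF _ _ y
            runs_Let_Call[OF _ _ y' runs_Let_Call[OF _ _ rest[unfolded eq_False[THEN iffD2, OF False]]
            runs_If_false[OF _ _ runs_Call[OF _ _ r]]]]]])
        (use lin in \<open>simp_all add: enc_items_def enc_item_def exactly_def\<close>)
    moreover have "r = Leaf \<and> (\<forall>a \<in> set (a # ls). \<not> extends n (y @ (Some a, b) # bs)) \<or>
        (\<exists>a. extends n (y @ (Some a, b) # bs) \<and> r = enc_items as (y @ [(Some a, b)]))"
      using spec False by auto
    ultimately show ?thesis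
      by blast
  qed
qed

lemma run_extend:
  assumes "n + (length y + 1 + length bs) + n \<le> B"
  shows "\<exists>r. R f_extend (Node (enc_list (map (\<lambda>a. enc_letter as (Some a)) as))
      (Node (enc_items as ((None, b) # bs)) (Node (enc_items as y) (Node (enc_nat n) X)))) r
      (t_extend K B) \<and>
    (r = Leaf \<and> (\<forall>a. \<not> extends n (y @ (Some a, b) # bs)) \<or>
     (\<exists>a. extends n (y @ (Some a, b) # bs) \<and> r = enc_items as (y @ [(Some a, b)])))"
proof -
  have "(length as + 1) * (t_rest K B + 2 * lin B + 100) \<le> t_extend K B"
    unfolding t_extend_def using B by (intro mult_le_mono) auto
  moreover obtain r where "R f_extend (Node (enc_list (map (\<lambda>a. enc_letter as (Some a)) as))
      (Node (enc_items as ((None, b) # bs)) (Node (enc_items as y) (Node (enc_nat n) X)))) r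
      ((length as + 1) * (t_rest K B + 2 * lin B + 100))"
    and "r = Leaf \<and> (\<forall>a. \<not> extends n (y @ (Some a, b) # bs)) \<or>
      (\<exists>a. extends n (y @ (Some a, b) # bs) \<and> r = enc_items as (y @ [(Some a, b)]))"
    using run_extend_list[OF assms, of as b] as(2) by auto
  ultimately show ?thesis
    using run_mono by blast
qed

text \<open>\<open>goal d\<close> leads to an accepting state in \<open>d + 1\<close> steps.\<close>

definition goal :: "nat \<Rightarrow> 'a item list" where
  "goal d = replicate d any @ [(None, True)]"

lemma goal_Cons: "goal d = (None, d = 0) # tl (goal d)"
  by (cases d) (auto simp: goal_def)

lemma goal_Suc: "goal (Suc d) = any # goal d"
  by (simp add: goal_def)

lemma length_goal: "length (goal d) = Suc d"
  by (simp add: goal_def)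

text \<open>For \<open>d = 0\<close> the new letter itself leads into the accepting state and
  receives the mark.\<close>

abbreviation extendable :: "nat \<Rightarrow> 'a item list \<Rightarrow> nat \<Rightarrow> 'a \<Rightarrow> bool" where
  "extendable n y d a \<equiv> extends n (y @ (Some a, d = 0) # tl (goal d))"

text \<open>Trying distances in increasing order yields the least one, on which the decrease of the
  potential relies.\<close>

lemma run_dist_from:
  assumes "n + (length y + 1 + (d + k)) + n \<le> B"
  shows "\<exists>r. R f_dist (Node (enc_nat k)
      (Node (enc_items as (goal d)) (Node (enc_items as y) (Node (enc_nat n) X)))) r
      ((k + 1) * (t_extend K B + K + 100)) \<and>
    (r = Leaf \<and> (\<forall>d'. d \<le> d' \<and> d' \<le> d + k \<longrightarrow> (\<forall>a. \<not> extendable n y d' a)) \<or>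
     (\<exists>d' a. d \<le> d' \<and> d' \<le> d + k \<and> extendable n y d' a \<and>
       (\<forall>d''. d \<le> d'' \<and> d'' < d' \<longrightarrow> (\<forall>a. \<not> extendable n y d'' a)) \<and>
       r = enc_items as (y @ [(Some a, d' = 0)])))"
  using assms
proof (induction k arbitrary: d)
  case 0
  obtain r where r: "R f_extend (Node (enc_list (map (\<lambda>a. enc_letter as (Some a)) as))
      (Node (enc_items as (goal d)) (Node (enc_items as y) (Node (enc_nat n) X)))) r (t_extend K B)"
    and spec: "r = Leaf \<and> (\<forall>a. \<not> extendable n y d a) \<or>
      (\<exists>a. extendable n y d a \<and> r = enc_items as (y @ [(Some a, d = 0)]))"
    using run_extend[of n y "tl (goal d)" "d = 0"] 0 unfolding goal_Cons[symmetric]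
    by (auto simp: length_goal)
  have "R f_dist (Node (enc_nat 0)
      (Node (enc_items as (goal d)) (Node (enc_items as y) (Node (enc_nat n) X)))) r
      ((0 + 1) * (t_extend K B + K + 100))"
  proof (cases "r = Leaf")
    case True
    then show ?thesis
      by - (rule run_dist_body, simp, rule runs_Let_Call[OF _ _ r runs_If_false[OF _ _
        runs_If_false[OF _ _ runs_simple]]], use cost_const in simp_all)
  next
    case False
    then show ?thesis
      by - (rule run_dist_body, simp, rule runs_Let_Call[OF _ _ r runs_If_true[OF _ _ runs_simple]],
        use cost_const in simp_all)
  qed
  moreover have "r = Leaf \<and> (\<forall>d'. d \<le> d' \<and> d' \<le> d + 0 \<longrightarrow> (\<forall>a. \<not> extendable n y d' a)) \<or>
     (\<exists>d' a. d \<le> d' \<and> d' \<le> d + 0 \<and> extendable n y d' a \<and>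
       (\<forall>d''. d \<le> d'' \<and> d'' < d' \<longrightarrow> (\<forall>a. \<not> extendable n y d'' a)) \<and>
       r = enc_items as (y @ [(Some a, d' = 0)]))"
    using spec by (metis add_0_right le_antisym not_less order_refl)
  ultimately show ?case
    by blast
next
  case (Suc k)
  obtain r where r: "R f_extend (Node (enc_list (map (\<lambda>a. enc_letter as (Some a)) as))
      (Node (enc_items as (goal d)) (Node (enc_items as y) (Node (enc_nat n) X)))) r (t_extend K B)"
    and spec: "r = Leaf \<and> (\<forall>a. \<not> extendable n y d a) \<or>
      (\<exists>a. extendable n y d a \<and> r = enc_items as (y @ [(Some a, d = 0)]))"
    using run_extend[of n y "tl (goal d)" "d = 0"] Suc.prems unfolding goal_Cons[symmetric]
    by (auto simp: length_goal)
  show ?case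
  proof (cases "r = Leaf")
    case True
    obtain r' where r': "R f_dist (Node (enc_nat k)
        (Node (enc_items as (goal (Suc d))) (Node (enc_items as y) (Node (enc_nat n) X)))) r'
        ((k + 1) * (t_extend K B + K + 100))"
      and spec': "r' = Leaf \<and> (\<forall>d'. Suc d \<le> d' \<and> d' \<le> Suc d + k \<longrightarrow> (\<forall>a. \<not> extendable n y d' a)) \<or>
       (\<exists>d' a. Suc d \<le> d' \<and> d' \<le> Suc d + k \<and> extendable n y d' a \<and>
         (\<forall>d''. Suc d \<le> d'' \<and> d'' < d' \<longrightarrow> (\<forall>a. \<not> extendable n y d'' a)) \<and>
         r' = enc_items as (y @ [(Some a, d' = 0)]))"
      using Suc.IH[of "Suc d"] Suc.prems unfolding add_Suc add_Suc_right by blast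
    have none: "\<not> extendable n y d a" for a
      using spec True by auto
    have "R f_dist (Node (enc_nat (Suc k))
      (Node (enc_items as (goal d)) (Node (enc_items as y) (Node (enc_nat n) X)))) r'
      ((Suc k + 1) * (t_extend K B + K + 100))"
      by (rule run_dist_body, simp, rule runs_Let_Call[OF _ _ r runs_If_false[OF _ _
        runs_If_true[OF _ _ runs_Call[OF _ _ r']]]]) (use True cost_const in \<open>simp_all add: goal_Suc\<close>)
    moreover have "d \<le> d' \<longleftrightarrow> d' = d \<or> Suc d \<le> d'" for d'
      by auto
    then have "r' = Leaf \<and> (\<forall>d'. d \<le> d' \<and> d' \<le> d + Suc k \<longrightarrow> (\<forall>a. \<not> extendable n y d' a)) \<or>
     (\<exists>d' a. d \<le> d' \<and> d' \<le> d + Suc k \<and> extendable n y d' a \<and>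
       (\<forall>d''. d \<le> d'' \<and> d'' < d' \<longrightarrow> (\<forall>a. \<not> extendable n y d'' a)) \<and>
       r' = enc_items as (y @ [(Some a, d' = 0)]))"
      using spec' none by (metis add_Suc add_Suc_right)
    ultimately show ?thesis
      by blast
  next
    case False
    then have "R f_dist (Node (enc_nat (Suc k))
      (Node (enc_items as (goal d)) (Node (enc_items as y) (Node (enc_nat n) X)))) r
      ((Suc k + 1) * (t_extend K B + K + 100))"
      by - (rule run_dist_body, simp, rule runs_Let_Call[OF _ _ r runs_If_true[OF _ _ runs_simple]],
        use cost_const in simp_all)
    moreover obtain a where "extendable n y d a" "r = enc_items as (y @ [(Some a, d = 0)])"
      using spec False by blast
    then have "\<exists>d' a. d \<le> d' \<and> d' \<le> d + Suc k \<and> extendable n y d' a \<and>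
       (\<forall>d''. d \<le> d'' \<and> d'' < d' \<longrightarrow> (\<forall>a. \<not> extendable n y d'' a)) \<and>
       r = enc_items as (y @ [(Some a, d' = 0)])"
      by (intro exI[of _ d] exI[of _ a] conjI) auto
    ultimately show ?thesis
      by blast
  qed
qed

lemma run_dist:
  assumes "n + (length y + 1 + n) + n \<le> B"
  shows "\<exists>r. R f_dist (Node (enc_nat n)
      (Node (Node (enc_item as (None, True)) Leaf) (Node (enc_items as y) (Node (enc_nat n) X)))) r
      (t_dist K B) \<and>
    (r = Leaf \<and> (\<forall>d \<le> n. \<forall>a. \<not> extendable n y d a) \<or>
     (\<exists>d a. extendable n y d a \<and> (\<forall>d' < d. \<forall>a. \<not> extendable n y d' a) \<and>
       r = enc_items as (y @ [(Some a, d = 0)])))"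
proof -
  have "(n + 1) * (t_extend K B + K + 100) \<le> t_dist K B"
    unfolding t_dist_def using assms by (intro mult_le_mono) auto
  moreover have "goal 0 = [(None, True)]"
    by (simp add: goal_def)
  then have "enc_items as (goal 0) = Node (enc_item as (None, True)) Leaf"
    by simp
  ultimately have dist: "R f_dist (Node (enc_nat n) (Node (enc_items as (goal 0)) (Node (enc_items as y)
      (Node (enc_nat n) X)))) r ((n + 1) * (t_extend K B + K + 100)) \<Longrightarrow>
    R f_dist (Node (enc_nat n) (Node (Node (enc_item as (None, True)) Leaf) (Node (enc_items as y)
      (Node (enc_nat n) X)))) r (t_dist K B)" for r
    using run_mono by simp
  have "n + (length y + 1 + (0 + n)) + n \<le> B"
    using assms by simp
  from run_dist_from[OF this] obtain r where r: "R f_dist (Node (enc_nat n) (Node (enc_items as (goal 0))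
      (Node (enc_items as y) (Node (enc_nat n) X)))) r ((n + 1) * (t_extend K B + K + 100))"
    and spec: "r = Leaf \<and> (\<forall>d. 0 \<le> d \<and> d \<le> 0 + n \<longrightarrow> (\<forall>a. \<not> extendable n y d a)) \<or>
     (\<exists>d a. 0 \<le> d \<and> d \<le> 0 + n \<and> extendable n y d a \<and>
       (\<forall>d'. 0 \<le> d' \<and> d' < d \<longrightarrow> (\<forall>a. \<not> extendable n y d' a)) \<and>
       r = enc_items as (y @ [(Some a, d = 0)]))"
    by (elim exE conjE)
  show ?thesis
  proof (intro exI conjI)
    show "R f_dist (Node (enc_nat n) (Node (Node (enc_item as (None, True)) Leaf) (Node (enc_items as y)
      (Node (enc_nat n) X)))) r (t_dist K B)"
      by (rule dist[OF r])
    show "r = Leaf \<and> (\<forall>d \<le> n. \<forall>a. \<not> extendable n y d a) \<or>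
     (\<exists>d a. extendable n y d a \<and> (\<forall>d' < d. \<forall>a. \<not> extendable n y d' a) \<and>
       r = enc_items as (y @ [(Some a, d = 0)]))"
      using spec by (simp only: add_0 le0 simp_thms) blast
  qed
qed

section \<open>From a refuted infix to a counterexample\<close>

lemma run_output:
  "R f_output (enc_items as (map exactly us)) (enc_word as (map fst us)) (60 * (length us + 1))"
proof (induction us)
  case Nil
  show ?case
    by (rule run_output_body, simp, rule runs_If_false[OF _ _ runs_simple])
      (simp_all add: enc_word_def)
next
  case (Cons u us)
  show ?case
    by (rule run_output_body, simp,
        rule runs_If_true[OF _ _ runs_Let_Call[OF _ _ Cons runs_simple]])
      (simp_all add: enc_word_def enc_item_def enc_letter_def exactly_def)
qed

definition counterexample :: "tree \<Rightarrow> bool" where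
  "counterexample r \<longleftrightarrow> (\<exists>u v. r = enc_answer as (No u v) \<and> correct_answer L M (No u v) \<and>
     length u \<le> B \<and> length v \<le> B)"

text \<open>\<open>Leaf\<close> would encode \<open>Yes\<close>, so the searches can use it to
  signal failure.\<close>

lemma counterexample_not_Leaf: "counterexample r \<Longrightarrow> r \<noteq> Leaf"
  unfolding counterexample_def by auto

lemma exactly_Pair: "exactly (a, b) = (Some a, b)"
  by (simp add: exactly_def)

text \<open>The period is already fixed and only the stem has free letters, so
  \<open>refuted_refine_letter\<close> promises a letter that succeeds. This is why
  \<open>pick_body\<close> has no case for an exhausted list.\<close>

lemma run_refine_from:
  assumes "v \<noteq> []" and "length u + j + length v \<le> B"
    and "refuted M L ((map exactly u @ replicate j any) \<frown> (map exactly v)\<^sup>\<omega>)"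
  shows "\<exists>r. R f_refine (Node (enc_items as (map exactly u)) (Node (enc_items as (replicate j any))
      (Node (enc_items as (map exactly v)) X))) r ((j + 1) * (t_pick B + K + 2 * lin B + 100)) \<and>
    counterexample r"
  using assms(2,3)
proof (induction j arbitrary: u)
  case 0
  have lin: "60 * (length u + 1) \<le> lin B" "60 * (length v + 1) \<le> lin B"
    using 0(1) by (simp_all add: lin_def)
  have "counterexample (Node (enc_word as (map fst u)) (enc_word as (map fst v)))"
    unfolding counterexample_def
    using refuted_exactly[of M L u v] 0 assms(1)
    by (intro exI[of _ "map fst u"] exI[of _ "map fst v"]) (simp del: iter_nth)
  moreover have "R f_refine (Node (enc_items as (map exactly u)) (Node (enc_items as (replicate 0 any))
      (Node (enc_items as (map exactly v)) X))) (Node (enc_word as (map fst u)) (enc_word as (map fst v)))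
      ((0 + 1) * (t_pick B + K + 2 * lin B + 100))"
    by (rule run_refine_body, simp, rule runs_If_false[OF _ _ runs_Let_Call[OF _ _ run_output[of u]
        runs_Let_Call[OF _ _ run_output[of v] runs_simple]]]) (use lin in simp_all)
  ultimately show ?case
    by blast
next
  case (Suc j)
  let ?T = "(j + 1) * (t_pick B + K + 2 * lin B + 100)"
  let ?ref = "\<lambda>a. refuted M L ((map exactly (u @ [(a, False)]) @ replicate j any) \<frown> (map exactly v)\<^sup>\<omega>)"
  have lin: "60 * (length u + 1) \<le> lin B" "60 * (length (u @ [(a, False)]) + 1) \<le> lin B" for a
    using Suc.prems(1) by (simp_all add: lin_def)
  \<comment> \<open>The two routines call each other: the inner induction over letters falls back on
    the outer hypothesis for a stem with one free letter less.\<close>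
  have pick: "\<exists>r. R f_pick (Node (enc_list (map (\<lambda>a. enc_letter as (Some a)) ls))
      (Node (enc_items as (map exactly u)) (Node (enc_items as (replicate j any))
      (Node (enc_items as (map exactly v)) X)))) r
      ((length ls + 1) * (t_query B + 2 * lin B + 100) + ?T) \<and> counterexample r"
    if "\<exists>a \<in> set ls. ?ref a" for ls
    using that
  proof (induction ls)
    case (Cons a ls)
    let ?u = "map exactly (u @ [(a, False)])"
    have q: "length ((?u @ replicate j any) @ map exactly v) \<le> B" "map exactly v \<noteq> []"
      using Suc.prems(1) assms(1) by simp_all
    note append1 = run_append[of "map (enc_item as) (map exactly u)" "[enc_item as (Some a, False)]"]
    note append2 = run_append[of "map (enc_item as) ?u" "map (enc_item as) (replicate j any)"]
    show ?case
    proof (cases "?ref a")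
      case True
      obtain r where r: "R f_refine (Node (enc_items as ?u) (Node (enc_items as (replicate j any))
          (Node (enc_items as (map exactly v)) X))) r ?T" "counterexample r"
      proof -
        have "length (u @ [(a, False)]) + j + length v \<le> B"
          using Suc.prems(1) by simp
        then show ?thesis
          using Suc.IH[OF _ True] that by blast
      qed
      have "R f_pick (Node (enc_list (map (\<lambda>a. enc_letter as (Some a)) (a # ls)))
        (Node (enc_items as (map exactly u)) (Node (enc_items as (replicate j any))
        (Node (enc_items as (map exactly v)) X)))) r
        ((length (a # ls) + 1) * (t_query B + 2 * lin B + 100) + ?T)"
        by (rule run_pick_body, simp, rule runs_Let_Call[OF _ _ append1 runs_Let_Call[OF _ _ append2
              runs_Let_Call[OF _ _ run_query[OF q] runs_If_false[OF _ _ runs_Call[OF _ _ r(1)]]]]])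
          (use True lin in \<open>simp_all add: enc_items_def enc_item_def exactly_def\<close>)
      then show ?thesis
        using r(2) by blast
    next
      case False
      obtain r where r: "R f_pick (Node (enc_list (map (\<lambda>a. enc_letter as (Some a)) ls))
          (Node (enc_items as (map exactly u)) (Node (enc_items as (replicate j any))
          (Node (enc_items as (map exactly v)) X)))) r
          ((length ls + 1) * (t_query B + 2 * lin B + 100) + ?T)" "counterexample r"
        using Cons False by auto
      have "R f_pick (Node (enc_list (map (\<lambda>a. enc_letter as (Some a)) (a # ls)))
        (Node (enc_items as (map exactly u)) (Node (enc_items as (replicate j any))
        (Node (enc_items as (map exactly v)) X)))) r
        ((length (a # ls) + 1) * (t_query B + 2 * lin B + 100) + ?T)"
        by (rule run_pick_body, simp, rule runs_Let_Call[OF _ _ append1 runs_Let_Call[OF _ _ append2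
              runs_Let_Call[OF _ _ run_query[OF q] runs_If_true[OF _ _ runs_Call[OF _ _ r(1)]]]]])
          (use False lin in \<open>simp_all add: enc_items_def enc_item_def exactly_def\<close>)
      then show ?thesis
        using r(2) by blast
    qed
  qed simp
  obtain a where "?ref a"
    using refuted_refine_letter[of M L "map exactly u" False "replicate j any" "(map exactly v)\<^sup>\<omega>"]
      Suc.prems(2) by (auto simp: exactly_Pair)
  then obtain r where r: "R f_pick (Node (enc_list (map (\<lambda>a. enc_letter as (Some a)) as))
      (Node (enc_items as (map exactly u)) (Node (enc_items as (replicate j any))
      (Node (enc_items as (map exactly v)) X)))) r
      ((length as + 1) * (t_query B + 2 * lin B + 100) + ?T)" "counterexample r"
    using pick[of as] as(2) by auto
  have "(length as + 1) * (t_query B + 2 * lin B + 100) \<le> t_pick B"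
    unfolding t_pick_def using B by (intro mult_le_mono) auto
  then have "R f_refine (Node (enc_items as (map exactly u)) (Node (enc_items as (replicate (Suc j) any))
      (Node (enc_items as (map exactly v)) X))) r ((Suc j + 1) * (t_pick B + K + 2 * lin B + 100))"
    by - (rule run_refine_body, simp, rule runs_If_true[OF _ _ runs_Call[OF _ _ r(1)]],
      use cost_const in simp_all)
  then show ?case
    using r(2) by blast
qed

lemma run_refine:
  assumes "v \<noteq> []" and "i + length v \<le> B" and "refutes i (map exactly v)"
  shows "\<exists>r. R f_refine (Node Leaf (Node (enc_items as (replicate i any))
      (Node (enc_items as (map exactly v)) X))) r (t_refine K B) \<and> counterexample r"
proof -
  have "(i + 1) * (t_pick B + K + 2 * lin B + 100) \<le> t_refine K B"
    unfolding t_refine_def using assms(2) by (intro mult_le_mono) auto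
  then show ?thesis
    using run_refine_from[of v "[]" i] run_mono[of f_refine] assms
    unfolding refutes_def list.map(1) enc_items_simps(1) append_Nil list.size(3) add_0 by blast
qed

text \<open>\<open>c\<close> accumulates the current prefix. Trying all prefixes here and all
  suffixes in \<open>run_suffix_list\<close> covers every nonempty infix.\<close>

lemma run_infix_from:
  assumes "n + (length c + length ys) \<le> B"
  shows "\<exists>r. R f_infix (Node (enc_items as (map exactly c)) (Node (enc_items as (map exactly ys))
      (Node (enc_nat n) X))) r ((length ys + 1) * (t_stem K B + lin B + 100) + t_refine K B) \<and>
    (counterexample r \<or> r = Leaf \<and>
      (\<forall>vs ws. ys = vs @ ws \<and> vs \<noteq> [] \<longrightarrow> (\<forall>i \<le> n. \<not> refutes i (map exactly (c @ vs)))))"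
  using assms
proof (induction ys arbitrary: c)
  case Nil
  show ?case
    by (intro exI[of _ Leaf] conjI)
      (rule run_infix_body, simp, rule runs_If_false[OF _ _ runs_simple], simp_all)
next
  case (Cons y ys)
  let ?c = "c @ [y]"
  have lin: "60 * (length c + 1) \<le> lin B"
    using Cons.prems by (simp add: lin_def)
  note append = run_append[of "map (enc_item as) (map exactly c)" "[enc_item as (exactly y)]"]
  obtain s where s: "R f_stem (Node (enc_nat n) (Node Leaf (Node (enc_items as (map exactly ?c)) X))) s
      (t_stem K B)"
    and spec: "s = Leaf \<and> (\<forall>i \<le> n. \<not> refutes i (map exactly ?c)) \<or>
     (\<exists>i \<le> n. refutes i (map exactly ?c) \<and> s = Node (enc_items as (replicate i any)) Leaf)"
  proof -
    have "map exactly ?c \<noteq> []" "n + length (map exactly ?c) \<le> B"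
      using Cons.prems by simp_all
    then show ?thesis
      using run_stem that by blast
  qed
  show ?case
  proof (cases "s = Leaf")
    case True
    obtain r where r: "R f_infix (Node (enc_items as (map exactly ?c)) (Node (enc_items as (map exactly ys))
        (Node (enc_nat n) X))) r ((length ys + 1) * (t_stem K B + lin B + 100) + t_refine K B)"
      and spec': "counterexample r \<or> r = Leaf \<and>
        (\<forall>vs ws. ys = vs @ ws \<and> vs \<noteq> [] \<longrightarrow> (\<forall>i \<le> n. \<not> refutes i (map exactly (?c @ vs))))"
    proof -
      have "n + (length ?c + length ys) \<le> B"
        using Cons.prems by simp
      then show ?thesis
        using Cons.IH that by blast
    qed
    have "R f_infix (Node (enc_items as (map exactly c)) (Node (enc_items as (map exactly (y # ys)))
      (Node (enc_nat n) X))) r ((length (y # ys) + 1) * (t_stem K B + lin B + 100) + t_refine K B)"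
      by (rule run_infix_body, simp, rule runs_If_true[OF _ _ runs_Let_Call[OF _ _ append
          runs_Let_Call[OF _ _ s runs_If_false[OF _ _ runs_Call[OF _ _ r]]]]])
        (use True lin in \<open>simp_all add: enc_items_def\<close>)
    moreover have none: "\<forall>i \<le> n. \<not> refutes i (map exactly (c @ vs))"
      if prems: "r = Leaf" "y # ys = vs @ ws" "vs \<noteq> []" for vs ws
    proof -
      obtain vs' where vs': "vs = y # vs'" "ys = vs' @ ws"
        using prems(2,3) by (cases vs) auto
      show ?thesis
      proof (cases "vs' = []")
        case True
        then show ?thesis
          using spec \<open>s = Leaf\<close> vs'(1) by simp
      next
        case False
        then show ?thesis
          using spec' prems(1) counterexample_not_Leaf vs' by fastforce
      qed
    qed
    then have "counterexample r \<or> r = Leaf \<and> (\<forall>vs ws. y # ys = vs @ ws \<and> vs \<noteq> [] \<longrightarrow>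
        (\<forall>i \<le> n. \<not> refutes i (map exactly (c @ vs))))"
      using spec' by (intro disjCI conjI allI impI) (simp, blast)
    ultimately show ?thesis
      by blast
  next
    case False
    then obtain i where i: "i \<le> n" "refutes i (map exactly ?c)"
      "s = Node (enc_items as (replicate i any)) Leaf"
      using spec by blast
    then obtain r where r: "R f_refine (Node Leaf (Node (enc_items as (replicate i any))
      (Node (enc_items as (map exactly ?c)) X))) r (t_refine K B)" "counterexample r"
      using run_refine[of ?c i] Cons.prems by auto
    have "R f_infix (Node (enc_items as (map exactly c)) (Node (enc_items as (map exactly (y # ys)))
      (Node (enc_nat n) X))) r ((length (y # ys) + 1) * (t_stem K B + lin B + 100) + t_refine K B)"
      by (rule run_infix_body, simp, rule runs_If_true[OF _ _ runs_Let_Call[OF _ _ append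
          runs_Let_Call[OF _ _ s runs_If_true[OF _ _ runs_Call[OF _ _ r(1)]]]]])
        (use i(3) lin in \<open>simp_all add: enc_items_def\<close>)
    then show ?thesis
      using r(2) by blast
  qed
qed

lemma run_suffix_list:
  assumes "n + length ys \<le> B"
  shows "\<exists>r. R f_suffix (Node (enc_items as (map exactly ys)) (Node (enc_nat n) X)) r
      ((length ys + 1) * (t_infix K B + 100)) \<and>
    (counterexample r \<or> r = Leaf \<and> (\<forall>us vs ws. ys = us @ vs @ ws \<and> vs \<noteq> [] \<longrightarrow>
      (\<forall>i \<le> n. \<not> refutes i (map exactly vs))))"
  using assms
proof (induction ys)
  case Nil
  show ?case
    by (intro exI[of _ Leaf] conjI)
      (rule run_suffix_body, simp, rule runs_If_false[OF _ _ runs_simple], simp_all)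
next
  case (Cons y ys)
  have "(length (y # ys) + 1) * (t_stem K B + lin B + 100) + t_refine K B \<le> t_infix K B"
    unfolding t_infix_def using Cons.prems by (intro add_mono mult_le_mono) auto
  then obtain s where s: "R f_infix (Node Leaf (Node (enc_items as (map exactly (y # ys)))
      (Node (enc_nat n) X))) s (t_infix K B)"
    and spec: "counterexample s \<or> s = Leaf \<and> (\<forall>vs ws. y # ys = vs @ ws \<and> vs \<noteq> [] \<longrightarrow>
      (\<forall>i \<le> n. \<not> refutes i (map exactly vs)))"
    using run_infix_from[of n "[]" "y # ys"] run_mono[of f_infix] Cons.prems
    unfolding list.map(1) enc_items_simps(1) append_Nil list.size(3) add_0 by blast
  show ?case
  proof (cases "s = Leaf")
    case True
    obtain r where r: "R f_suffix (Node (enc_items as (map exactly ys)) (Node (enc_nat n) X)) r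
        ((length ys + 1) * (t_infix K B + 100))"
      and spec': "counterexample r \<or> r = Leaf \<and> (\<forall>us vs ws. ys = us @ vs @ ws \<and> vs \<noteq> [] \<longrightarrow>
        (\<forall>i \<le> n. \<not> refutes i (map exactly vs)))"
    proof -
      have "n + length ys \<le> B"
        using Cons.prems by simp
      then show ?thesis
        using Cons.IH that by blast
    qed
    have "R f_suffix (Node (enc_items as (map exactly (y # ys))) (Node (enc_nat n) X)) r
      ((length (y # ys) + 1) * (t_infix K B + 100))"
      by (rule run_suffix_body, simp, rule runs_If_true[OF _ _ runs_Let_Call[OF _ _ s
          runs_If_false[OF _ _ runs_Call[OF _ _ r]]]])
        (use True in simp_all)
    moreover have none: "\<forall>i \<le> n. \<not> refutes i (map exactly vs)"
      if "r = Leaf" "y # ys = us @ vs @ ws" "vs \<noteq> []" for us vs ws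
    proof (cases us)
      case Nil
      then have "y # ys = vs @ ws"
        using that(2) by simp
      moreover have "\<not> counterexample s"
        using True counterexample_not_Leaf by blast
      ultimately show ?thesis
        using spec that(3) by metis
    next
      case (Cons u us')
      then have "ys = us' @ vs @ ws"
        using that(2) by simp
      then show ?thesis
        using spec' that(1,3) counterexample_not_Leaf[of r] by metis
    qed
    then have "counterexample r \<or> r = Leaf \<and> (\<forall>us vs ws. y # ys = us @ vs @ ws \<and> vs \<noteq> [] \<longrightarrow>
        (\<forall>i \<le> n. \<not> refutes i (map exactly vs)))"
      using spec' by (intro disjCI conjI allI impI) (simp, blast)
    ultimately show ?thesis
      by blast
  next
    case False
    then have "counterexample s"
      using spec by blast
    moreover have "R f_suffix (Node (enc_items as (map exactly (y # ys))) (Node (enc_nat n) X)) s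
      ((length (y # ys) + 1) * (t_infix K B + 100))"
      by (rule run_suffix_body, simp, rule runs_If_true[OF _ _ runs_Let_Call[OF _ _ s
          runs_If_true[OF _ _ runs_simple]]])
        (use False in simp_all)
    ultimately show ?thesis
      by blast
  qed
qed

lemma run_suffix:
  assumes "n + length ys \<le> B"
  shows "\<exists>r. R f_suffix (Node (enc_items as (map exactly ys)) (Node (enc_nat n) X)) r (t_suffix K B) \<and>
    (counterexample r \<or> r = Leaf \<and> (\<forall>us vs ws. ys = us @ vs @ ws \<and> vs \<noteq> [] \<longrightarrow>
      (\<forall>i \<le> n. \<not> refutes i (map exactly vs))))"
proof -
  have "(length ys + 1) * (t_infix K B + 100) \<le> t_suffix K B"
    unfolding t_suffix_def using assms by (intro mult_le_mono) auto
  then show ?thesis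
    using run_suffix_list[OF assms] run_mono[of f_suffix] by blast
qed

end


section \<open>The main loop\<close>

text \<open>\<open>3 * S + (S + 1) * (S + 1)\<close> bounds the initial potential.
  \<open>4 * N + 4\<close> leaves room for the longest query: a stem, \<open>y\<close>, a goal and a
  free part, each of about \<open>N\<close> items at most.\<close>

locale bounded_search = search as M L qs B + product M T L
  for as :: "'a list" and M :: "('q, 'a) acceptor" and L :: "'a word set" and qs :: "'q list"
    and B :: nat and T :: "('t, 'a) acceptor" +
  fixes N :: nat
  assumes N: "3 * S + (S + 1) * (S + 1) \<le> N" and NB: "4 * N + 4 \<le> B"
begin

section \<open>Marks, distances and the decrease of the potential\<close>

definition marked :: "('a \<times> bool) list \<Rightarrow> nat" where
  "marked y = length (filter snd y)"

definition dist :: "('a \<times> bool) list \<Rightarrow> nat" where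
  "dist y = (LEAST d. good (map exactly y @ goal d))"

text \<open>
  Once the bound \<open>n\<close> has reached \<open>2 * S\<close>, every step adds a marked position or comes
  closer to the next one; more than \<open>S\<close> marked positions are impossible.
\<close>

definition potential :: "nat \<Rightarrow> ('a \<times> bool) list \<Rightarrow> nat" where
  "potential n y = (if n < 2 * S then (2 * S - n) + ((S + 1) * (S + 1) + S)
     else (S + 1 - marked y) * (S + 1) + dist y)"

lemma dist:
  assumes "good (map exactly y)"
  shows "good (map exactly y @ goal (dist y))" and "dist y \<le> S"
proof -
  obtain d where d: "d \<le> S" "good (map exactly y @ goal d)"
    using good_reach_accepting[OF assms] unfolding goal_def by blast
  show "good (map exactly y @ goal (dist y))"
    unfolding dist_def using d(2) by (rule LeastI)
  have "dist y \<le> d"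
    unfolding dist_def using d(2) by (rule Least_le)
  then show "dist y \<le> S"
    using d(1) by linarith
qed

lemma potential_le:
  assumes "good (map exactly y)"
  shows "(S + 1 - marked y) * (S + 1) + dist y \<le> (S + 1) * (S + 1) + S"
  using dist(2)[OF assms] by (intro add_mono mult_le_mono) auto

text \<open>A positive test can be trusted however small \<open>n\<close> is, so the invariant also
  holds while the bound is still growing.\<close>

lemma good_if_extends:
  assumes "extends n p" and "p \<noteq> []"
  shows "good p"
proof -
  obtain i j where "refuted M L (replicate i any \<frown> (p @ replicate j any)\<^sup>\<omega>)"
    using assms(1) unfolding extends_def refutes_def by blast
  then have "good (p @ replicate j any)"
    using good_if_refuted assms(2) by simp
  then show ?thesis
    by (rule good_prefix)
qed

text \<open>The threshold \<open>2 * S\<close> in \<open>potential\<close> is the longest free part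
  that \<open>refuted_if_good\<close> may require.\<close>

lemma extends_if_good:
  assumes "good p" and "p \<noteq> []" and "2 * S \<le> n"
  shows "extends n p"
proof -
  obtain i j where "i \<le> S" "j \<le> 2 * S" "refuted M L (replicate i any \<frown> (p @ replicate j any)\<^sup>\<omega>)"
    using refuted_if_good[OF assms(1,2)] by blast
  then show ?thesis
    using assms(3) unfolding extends_def refutes_def
    by (intro exI[of _ j] conjI exI[of _ i]) auto
qed

text \<open>More marks would yield an infix by \<open>refuted_infix\<close>, with a stem of at most
  \<open>S \<le> n\<close> letters; the preceding search would have found it.\<close>

lemma marked_le:
  assumes "good (map exactly y)" and "S \<le> n"
    and "\<And>us vs ws. y = us @ vs @ ws \<Longrightarrow> vs \<noteq> [] \<Longrightarrow> \<forall>i \<le> n. \<not> refutes i (map exactly vs)"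
  shows "marked y \<le> S"
proof (rule ccontr)
  assume "\<not> marked y \<le> S"
  moreover have "{j. j < length (map exactly y) \<and> snd (map exactly y ! j)} = {j. j < length y \<and> snd (y ! j)}"
    by (auto simp: exactly_def)
  ultimately have "card {j. j < length (map exactly y) \<and> snd (map exactly y ! j)} > S"
    by (simp add: marked_def length_filter_conv_card)
  then obtain us vs ws i where *: "i \<le> S" "map exactly y = us @ vs @ ws" "vs \<noteq> []"
    "refutes i vs"
    using refuted_infix[OF assms(1)] unfolding refutes_def by blast
  obtain us' xs where xs: "y = us' @ xs" "vs @ ws = map exactly xs"
    using *(2) unfolding map_eq_append_conv by blast
  obtain vs' ws' where "xs = vs' @ ws'" "vs = map exactly vs'"
    using xs(2)[symmetric] unfolding map_eq_append_conv by blast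
  then show False
    using assms(2) assms(3)[of us' vs' ws'] * xs(1) by auto
qed

text \<open>A step raises \<open>n\<close> by one and lowers the potential by at least one, so
  \<open>n + potential n y \<le> N\<close> is preserved and keeps all lists short.\<close>

lemma run_main:
  assumes "good (map exactly y)" and "length y \<le> n" and "n + potential n y \<le> N"
  shows "\<exists>r. R f_main (Node (enc_nat n) (Node (enc_items as (map exactly y)) X)) r
    ((potential n y + 1) * t_main K B) \<and> counterexample r"
  using assms
proof (induction "potential n y" arbitrary: n y rule: less_induct)
  case less
  have "n + length y \<le> B" "n + (length (map exactly y) + 1 + n) + n \<le> B"
    using less.prems NB by simp_all
  note bounds = this
  obtain s where s: "R f_suffix (Node (enc_items as (map exactly y)) (Node (enc_nat n) X)) s (t_suffix K B)"
    and s_spec: "counterexample s \<or> s = Leaf \<and> (\<forall>us vs ws. y = us @ vs @ ws \<and> vs \<noteq> [] \<longrightarrow>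
      (\<forall>i \<le> n. \<not> refutes i (map exactly vs)))"
    using run_suffix[OF bounds(1)] by blast
  show ?case
  proof (cases "s = Leaf")
    case False
    have "R f_main (Node (enc_nat n) (Node (enc_items as (map exactly y)) X)) s
      ((potential n y + 1) * t_main K B)"
      by (rule run_main_body, simp, rule runs_Let_Call[OF _ _ s runs_If_true[OF _ _ runs_simple]])
        (use False in \<open>simp_all add: t_main_def\<close>)
    then show ?thesis
      using s_spec False by blast
  next
    case True
    then have none: "\<And>us vs ws. y = us @ vs @ ws \<Longrightarrow> vs \<noteq> [] \<Longrightarrow>
        \<forall>i \<le> n. \<not> refutes i (map exactly vs)"
      using s_spec counterexample_not_Leaf by blast
    obtain r where r: "R f_dist (Node (enc_nat n) (Node (Node (enc_item as (None, True)) Leaf)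
        (Node (enc_items as (map exactly y)) (Node (enc_nat n) X)))) r (t_dist K B)"
      and r_spec: "r = Leaf \<and> (\<forall>d \<le> n. \<forall>a. \<not> extendable n (map exactly y) d a) \<or>
       (\<exists>d a. extendable n (map exactly y) d a \<and>
         (\<forall>d' < d. \<forall>a. \<not> extendable n (map exactly y) d' a) \<and>
         r = enc_items as (map exactly y @ [(Some a, d = 0)]))"
      using run_dist[OF bounds(2)] by blast
    have good_ext: "good (map exactly (y @ [(a, d = 0)]) @ tl (goal d))"
      if "extendable n (map exactly y) d a" for d a
      using good_if_extends[OF that] by (simp add: exactly_Pair)
    have "\<exists>y'. r = enc_items as (map exactly y') \<and> good (map exactly y') \<and> length y' \<le> Suc n \<and>
      potential (Suc n) y' < potential n y"
    proof (cases "n < 2 * S")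
      case small: True
      \<comment> \<open>Below the threshold the potential ignores \<open>y\<close>, so
        \<open>y\<close> may even be discarded. At the threshold \<open>potential_le\<close> bounds
        the new value.\<close>
      have "potential (Suc n) y' < potential n y" if "good (map exactly y')" for y'
      proof -
        define m where "m = (S + 1 - marked y') * (S + 1) + dist y'"
        define P where "P = (S + 1) * (S + 1) + S"
        have "m \<le> P"
          using potential_le[OF that] by (simp only: m_def P_def)
        then show ?thesis
          using small unfolding potential_def m_def[symmetric] P_def[symmetric] by auto
      qed
      moreover have "\<exists>y'. r = enc_items as (map exactly y') \<and> good (map exactly y') \<and> length y' \<le> Suc n"
        using r_spec
      proof
        \<comment> \<open>\<open>Leaf\<close> also encodes the empty list, so after a failure the
          loop goes on with \<open>[]\<close> without a case distinction in the program.\<close>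
        assume "r = Leaf \<and> (\<forall>d \<le> n. \<forall>a. \<not> extendable n (map exactly y) d a)"
        moreover have "good []"
          using good_prefix[of "[]"] less.prems(1) by simp
        ultimately show ?thesis
          by (intro exI[of _ "[]"]) simp
      next
        assume "\<exists>d a. extendable n (map exactly y) d a \<and>
          (\<forall>d' < d. \<forall>a. \<not> extendable n (map exactly y) d' a) \<and>
          r = enc_items as (map exactly y @ [(Some a, d = 0)])"
        then obtain d a where "extendable n (map exactly y) d a"
          "r = enc_items as (map exactly (y @ [(a, d = 0)]))"
          by (auto simp: exactly_Pair)
        then show ?thesis
          using good_prefix[OF good_ext] less.prems(2) by (intro exI[of _ "y @ [(a, d = 0)]"]) simp
      qed
      ultimately show ?thesis
        by blast
    next
      case False
      then have large: "2 * S \<le> n"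
        by simp
      have marked: "marked y \<le> S"
        using marked_le[OF less.prems(1) _ none] large by simp
      \<comment> \<open>At distance \<open>dist y\<close> some letter passes the test, so the search
        succeeds with a distance of at most \<open>dist y\<close>.\<close>
      have "good (map exactly y @ (None, dist y = 0) # tl (goal (dist y)))"
        using dist(1)[OF less.prems(1)] goal_Cons[of "dist y"] by simp
      then obtain a where "good (map exactly y @ (Some a, dist y = 0) # tl (goal (dist y)))"
        using good_refine_letter by blast
      then have ext: "extendable n (map exactly y) (dist y) a"
        using extends_if_good large by blast
      moreover have "dist y \<le> n"
        using dist(2)[OF less.prems(1)] large by simp
      ultimately obtain d a where "extendable n (map exactly y) d a"
        "r = enc_items as (map exactly y @ [(Some a, d = 0)])"
        "\<forall>d' < d. \<forall>a. \<not> extendable n (map exactly y) d' a"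
        using r_spec by blast
      moreover from this have "d \<le> dist y"
        using ext not_less by blast
      ultimately have d: "extendable n (map exactly y) d a" "d \<le> dist y"
        "r = enc_items as (map exactly (y @ [(a, d = 0)]))"
        by (simp_all add: exactly_Pair)
      define y' where "y' = y @ [(a, d = 0)]"
      have good': "good (map exactly y')"
        using good_prefix[OF good_ext[OF d(1)]] by (simp only: y'_def)
      \<comment> \<open>A new mark gains \<open>S + 1\<close>, which outweighs a new distance of at
        most \<open>S\<close>. Otherwise one step towards the goal is done and \<open>d - 1\<close>
        further free steps suffice.\<close>
      have "(S + 1 - marked y') * (S + 1) + dist y' < (S + 1 - marked y) * (S + 1) + dist y"
      proof (cases "d = 0")
        case True
        then have "S + 1 - marked y = Suc (S + 1 - marked y')"
          using marked by (simp add: y'_def marked_def)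
        then show ?thesis
          using dist(2)[OF good'] by simp
      next
        case False
        then obtain d' where d': "d = Suc d'"
          by (cases d) auto
        have "good (map exactly y' @ goal d')"
          using good_ext[OF d(1)] unfolding d' goal_Suc by (simp add: y'_def d')
        then have "dist y' \<le> d'"
          unfolding dist_def by (rule Least_le)
        then show ?thesis
          using d(2) d' by (simp add: y'_def marked_def)
      qed
      then show ?thesis
        using good' d(3) large less.prems(2) by (intro exI[of _ y']) (simp add: potential_def y'_def)
    qed
    then obtain y' where y': "r = enc_items as (map exactly y')" "good (map exactly y')"
      "length y' \<le> Suc n" "potential (Suc n) y' < potential n y"
      by blast
    obtain m where m: "R f_main (Node (enc_nat (Suc n)) (Node (enc_items as (map exactly y')) X)) m
        ((potential (Suc n) y' + 1) * t_main K B)" "counterexample m"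
      using less.hyps[OF y'(4,2,3)] y'(4) less.prems(3) by auto
    have "(potential (Suc n) y' + 1) * t_main K B + t_main K B \<le> (potential n y + 1) * t_main K B"
      using mult_le_mono1[of "potential (Suc n) y' + 2" "potential n y + 1" "t_main K B"] y'(4)
      by simp
    then have "R f_main (Node (enc_nat n) (Node (enc_items as (map exactly y)) X)) m
      ((potential n y + 1) * t_main K B)"
      by - (rule run_main_body, simp, rule runs_Let_Call[OF _ _ s runs_If_false[OF _ _
        runs_Let_Call[OF _ _ r runs_Call[OF _ _ m(1)]]]],
        use True y'(1) cost_const in \<open>simp_all add: t_main_def\<close>)
    then show ?thesis
      using m(2) by blast
  qed
qed

lemma run_start:
  "\<exists>ans. R f_start X (enc_answer as ans) (t_query B + (N + 1) * t_main K B + K + 100) \<and>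
    correct_answer L M ans \<and> size (enc_answer as ans) \<le> 2 * (B * (B + 1)) + 1"
proof -
  have q: "length ([] @ [any]) \<le> B" "[any] \<noteq> []"
    using NB by simp_all
  have iff: "refuted M L ([] \<frown> [any]\<^sup>\<omega>) \<longleftrightarrow> \<not> language M \<subseteq> L"
    unfolding conc_iter_any by (rule refuted_any)
  show ?thesis
  proof (cases "language M \<subseteq> L")
    case True
    have "R f_start X Leaf (t_query B + (N + 1) * t_main K B + K + 100)"
      by (rule run_start_body, simp, rule runs_Let_Call[OF _ _ run_query[OF q, unfolded iff]
        runs_If_true[OF _ _ runs_simple]]) (use True cost_const in simp_all)
    then show ?thesis
      using True by (intro exI[of _ Yes]) simp
  next
    case False
    have "good [any]"
      using good_if_refuted[of "[]" "[any]"] iff False by simp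
    then have good: "good (map exactly [])"
      using good_prefix[of "[]" "[any]"] by simp
    have "potential 0 [] \<le> 3 * S + (S + 1) * (S + 1)"
      using potential_le[OF good] by (auto simp: potential_def)
    then have p: "potential 0 [] \<le> N"
      using N by linarith
    then obtain r where r: "R f_main (Node (enc_nat 0) (Node (enc_items as (map exactly [])) X)) r
      ((potential 0 [] + 1) * t_main K B)" "counterexample r"
      using run_main[OF good, of 0] by auto
    have "(potential 0 [] + 1) * t_main K B \<le> (N + 1) * t_main K B"
      using p by (intro mult_le_mono) auto
    note main = run_mono[OF r(1) this]
    have "R f_start X r (t_query B + (N + 1) * t_main K B + K + 100)"
      by (rule run_start_body, simp, rule runs_Let_Call[OF _ _ run_query[OF q, unfolded iff]
        runs_If_false[OF _ _ runs_Call[OF _ _ main]]]) (use False cost_const in simp_all)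
    moreover obtain u v where uv: "r = enc_answer as (No u v)" "correct_answer L M (No u v)"
      "length u \<le> B" "length v \<le> B"
      using r(2) unfolding counterexample_def by blast
    moreover have "size (enc_word as w) \<le> B * (B + 1)" if "length w \<le> B" for w
    proof -
      have "length (takeWhile P as) \<le> B" for P
        using length_takeWhile_le[of P as] B(1) by linarith
      then have "size (enc_word as w) \<le> length w * (B + 1)"
        unfolding enc_word_def by (intro size_enc_list_map) (simp add: size_enc_nat)
      also have "\<dots> \<le> B * (B + 1)"
        using that by (rule mult_le_mono1)
      finally show ?thesis .
    qed
    from this[OF uv(3)] this[OF uv(4)] have "size r \<le> 2 * (B * (B + 1)) + 1"
      using uv(1) by simp
    ultimately show ?thesis
      by (intro exI[of _ "No u v"]) simp
  qed
qed

end


section \<open>Polynomial bounds\<close>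

definition poly_bounded :: "(nat \<Rightarrow> nat) \<Rightarrow> bool" where
  "poly_bounded f \<longleftrightarrow> (\<exists>c k. \<forall>n. f n \<le> c * (n + 1) ^ k)"

lemma poly_bounded_const: "poly_bounded (\<lambda>_. c)"
  unfolding poly_bounded_def by (intro exI[of _ c] exI[of _ 0]) simp

lemma poly_bounded_id: "poly_bounded (\<lambda>n. n)"
  unfolding poly_bounded_def by (intro exI[of _ 1] exI[of _ 1]) simp

lemma poly_bounded_add:
  assumes "poly_bounded f" and "poly_bounded g"
  shows "poly_bounded (\<lambda>n. f n + g n)"
proof -
  obtain c k d l where fg: "\<And>n. f n \<le> c * (n + 1) ^ k" "\<And>n. g n \<le> d * (n + 1) ^ l"
    using assms unfolding poly_bounded_def by blast
  have "f n + g n \<le> (c + d) * (n + 1) ^ (k + l)" for n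
  proof -
    have "(n + 1) ^ k \<le> (n + 1) ^ (k + l)" "(n + 1) ^ l \<le> (n + 1) ^ (k + l)"
      by (rule power_increasing; simp)+
    then have "c * (n + 1) ^ k + d * (n + 1) ^ l \<le> c * (n + 1) ^ (k + l) + d * (n + 1) ^ (k + l)"
      by (intro add_mono mult_le_mono2)
    then show ?thesis
      using fg[of n] by (simp add: distrib_right)
  qed
  then show ?thesis
    unfolding poly_bounded_def by blast
qed

lemma poly_bounded_mult:
  assumes "poly_bounded f" and "poly_bounded g"
  shows "poly_bounded (\<lambda>n. f n * g n)"
proof -
  obtain c k d l where fg: "\<And>n. f n \<le> c * (n + 1) ^ k" "\<And>n. g n \<le> d * (n + 1) ^ l"
    using assms unfolding poly_bounded_def by blast
  have "f n * g n \<le> (c * d) * (n + 1) ^ (k + l)" for n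
    using mult_le_mono[OF fg[of n]] by (simp add: power_add ac_simps)
  then show ?thesis
    unfolding poly_bounded_def by blast
qed

text \<open>\<open>[:[:1, 1:], 1:]\<close> is \<open>1 + n + m\<close>: the outer indeterminate is
  evaluated at the constant \<open>[:m:]\<close>, the inner one at \<open>n\<close>.\<close>

lemma poly_bounded_poly:
  assumes "poly_bounded f"
  shows "\<exists>p :: nat poly poly. \<forall>m n. f (m + n) \<le> poly (poly p [:m:]) n"
proof -
  obtain c k where f: "\<And>n. f n \<le> c * (n + 1) ^ k"
    using assms unfolding poly_bounded_def by blast
  define p :: "nat poly poly" where "p = [:[:c:]:] * [:[:1, 1:], 1:] ^ k"
  have "poly (poly p [:m:]) n = c * (m + n + 1) ^ k" for m n
    unfolding p_def by (simp add: poly_mult poly_power ac_simps)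
  then show ?thesis
    using f by (intro exI[of _ p]) simp
qed


theorem theorem6p3:
  fixes as :: "'a::finite list"
  assumes "distinct as" and "set as = UNIV"
  shows "\<exists>(R :: program) (p :: nat poly poly).
    \<forall>(M :: (nat, 'a) acceptor) (x :: tree) (L :: 'a word set) (T :: (nat, 'a) acceptor).
      encodes as x M \<and> buchi T \<and> deterministic T \<and> language T = L \<longrightarrow>
      (\<exists>(ans :: 'a answer) (t :: nat) (queries :: tree list).
         computes R (subset_oracle as L) x (enc_answer as ans) t queries \<and>
         correct_answer L M ans \<and>
         t \<le> poly (poly p [:card (states M):]) (card (states T)) \<and>
         (deterministic M \<longrightarrow>
            (\<forall>y \<in> set queries. \<exists>N :: (nat, 'a) acceptor. encodes as y N \<and> deterministic N)))"
proof -
  \<comment> \<open>Bounds for \<open>S\<close>, \<open>N\<close> and \<open>B\<close> in terms of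
    \<open>z\<close>, the total number of states of both acceptors. They serve the analysis only:
    the program depends on the alphabet alone.\<close>
  define prod_size where "prod_size z = z * (z + 1)" for z :: nat
  define steps where "steps z = 3 * prod_size z + (prod_size z + 1) * (prod_size z + 1)" for z
  define width where "width z = 4 * steps z + 4 + length as + z" for z
  define K where "K = const_cost as"
  define f where "f z = t_query (width z) + (steps z + 1) * t_main K (width z) + K + 100 +
    (2 * (width z * (width z + 1)) + 1)" for z
  have "poly_bounded f"
    unfolding f_def t_main_def t_suffix_def t_infix_def t_refine_def t_pick_def t_dist_def t_extend_def
      t_rest_def t_stem_def t_query_def query_size_def t_levels_def t_rows_def t_letters_def t_spread_def
      lin_def width_def steps_def prod_size_def
    by (intro poly_bounded_add poly_bounded_mult poly_bounded_const poly_bounded_id)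
  then obtain p :: "nat poly poly" where p: "\<And>m n. f (m + n) \<le> poly (poly p [:m:]) n"
    using poly_bounded_poly by blast
  show ?thesis
  proof (intro exI[of _ "search_program as"] exI[of _ p] allI impI)
    fix M :: "(nat, 'a) acceptor" and x :: tree and L :: "'a word set" and T :: "(nat, 'a) acceptor"
    assume *: "encodes as x M \<and> buchi T \<and> deterministic T \<and> language T = L"
    then obtain qs where qs: "buchi M" "distinct qs" "set qs = states M" "x = enc_acceptor as qs M"
      unfolding encodes_def by blast
    define z where "z = card (states M) + card (states T)"
    have "length qs \<le> z"
      using qs(2,3) distinct_card unfolding z_def by fastforce
    interpret product M T L
      using * qs(1) by unfold_locales auto
    interpret s: search as M L qs "width z"
      using assms qs \<open>length qs \<le> z\<close> by unfold_locales (auto simp: width_def)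
    have S_le: "product.S M T \<le> prod_size z"
      unfolding product.S_def[OF product_axioms] prod_size_def z_def by (intro mult_le_mono) auto
    interpret bounded_search as M L qs "width z" T "steps z"
      using S_le by unfold_locales (auto simp: steps_def width_def intro!: add_mono mult_le_mono)
    obtain ans where ans: "correct_answer L M ans"
      "size (enc_answer as ans) \<le> 2 * (width z * (width z + 1)) + 1"
      "run (search_program as) (subset_oracle as L)
        (\<lambda>y. deterministic M \<longrightarrow> (\<exists>N :: (nat, 'a) acceptor. encodes as y N \<and> deterministic N))
        0 x (enc_answer as ans) (t_query (width z) + (steps z + 1) * t_main K (width z) + K + 100)"
      using run_start unfolding K_def qs(4) by blast
    then obtain t qs' where eval: "eval (search_program as) (subset_oracle as L) [x] (search_program as ! 0)
        (enc_answer as ans) t qs'"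
      "t \<le> t_query (width z) + (steps z + 1) * t_main K (width z) + K + 100"
      "\<forall>y \<in> set qs'. deterministic M \<longrightarrow> (\<exists>N :: (nat, 'a) acceptor. encodes as y N \<and> deterministic N)"
      unfolding run_def runs_def by blast
    have "t + size (enc_answer as ans) \<le> f z"
      using eval(2) ans(2) unfolding f_def by linarith
    also have "\<dots> \<le> poly (poly p [:card (states M):]) (card (states T))"
      unfolding z_def by (rule p)
    finally have "t + size (enc_answer as ans) \<le> poly (poly p [:card (states M):]) (card (states T))" .
    moreover have "computes (search_program as) (subset_oracle as L) x (enc_answer as ans)
        (t + size (enc_answer as ans)) qs'"
      unfolding computes_def using eval(1) by auto
    ultimately show "\<exists>(ans :: 'a answer) (t :: nat) (queries :: tree list).
         computes (search_program as) (subset_oracle as L) x (enc_answer as ans) t queries \<and>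
         correct_answer L M ans \<and>
         t \<le> poly (poly p [:card (states M):]) (card (states T)) \<and>
         (deterministic M \<longrightarrow>
            (\<forall>y \<in> set queries. \<exists>N :: (nat, 'a) acceptor. encodes as y N \<and> deterministic N))"
      using ans(1) eval(3) by blast
  qed
qed

end
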